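(* Suppose that $p\in[0,1/2]$ and $\beta\in[0,1]$. For any $\varepsilon>0$ and any $S_0\in\mathcal{D}\setminus\{\mathcal{D}_0\}$, $$\mathbb{E}_{\beta,p}[\tau^{2+\varepsilon}\mid\xi_0=S_0]=\infty .$$
   Context: Configurations: let $\mathcal{D}'\subset\{0,1\}^{\mathbb{Z}}$ be the set of configurations with finitely many $0$'s to the left of the origin and finitely many $1$'s to the right. Call $S,S'\in\mathcal{D}'$ equivalent if they are translates of each other, and let $\mathcal{D}$ be the (countable) set of equivalence classes. So each $S\in\mathcal{D}$ is an infinite string of $1$'s, followed by a finite string of $0$'s and $1$'s, followed by an infinite string of $0$'s, modulo translation. The ground state is $\mathcal{D}_0=\ldots 111000\ldots$ (up to translation). An unlike pair is a pair of adjacent sites with labels $01$ or $10$ (read left to right); each configuration has finitely many of them and at least one. Process: for $\beta,p\in[0,1]$ the discrete-time exclusion-voter process $\xi=(\xi_t)_{t\in\mathbb{Z}^+}$, $\mathbb{Z}^+=\{0,1,2,\ldots\}$, is the time-homogeneous Markov chain on $\mathcal{D}$ with the following one-step dynamics. At each time step, independently, a voter move is chosen with probability $\beta$ and an exclusion move with probability $1-\beta$; then one of the unlike pairs of the current configuration is chosen uniformly at random. In a voter move the chosen pair is replaced by $00$ or by $11$, each with probability $1/2$. In an exclusion move, a chosen pair $01$ becomes $10$ with probability $p$ (otherwise no change), and a chosen pair $10$ becomes $01$ with probability $1-p$ (otherwise no change). Its law and expectation are denoted $\mathbb{P}_{\beta,p}$, $\mathbb{E}_{\beta,p}$. Relaxation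 time: $\tau=\min\{t\in\mathbb{N}:\xi_t=\mathcal{D}_0\}$, $\mathbb{N}=\{1,2,\ldots\}$, with $\tau=+\infty$ if there is no such $t$. *)

theory Defs
  imports "HOL-Probability.Probability"
begin

section \<open>Configurations modulo translation\<close>

text \<open>A label sequence is a function \<^typ>\<open>int \<Rightarrow> bool\<close>, with \<^const>\<open>True\<close> for the label 1 and
  \<^const>\<open>False\<close> for the label 0.\<close>

definition config :: "(int \<Rightarrow> bool) \<Rightarrow> bool" where
  "config S \<longleftrightarrow> finite {x. x < 0 \<and> \<not> S x} \<and> finite {x. x > 0 \<and> S x}"

definition translate_equiv :: "(int \<Rightarrow> bool) \<Rightarrow> (int \<Rightarrow> bool) \<Rightarrow> bool" where
  "translate_equiv S T \<longleftrightarrow> config S \<and> config T \<and> (\<exists>k. \<forall>x. T x = S (x + k))"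

lemma config_ground: "config (\<lambda>x. x < 0)"
  by (auto simp: config_def)

lemma part_equivp_translate_equiv: "part_equivp translate_equiv"
proof (rule part_equivpI)
  show "\<exists>S. translate_equiv S S"
    using config_ground by (intro exI[of _ "\<lambda>x. x < 0"]) (auto simp: translate_equiv_def intro: exI[of _ 0])
  show "symp translate_equiv"
  proof (rule sympI)
    fix S T assume *: "translate_equiv S T"
    then obtain k where "\<forall>x. T x = S (x + k)" by (auto simp: translate_equiv_def)
    then have "\<forall>x. S x = T (x + (- k))" by simp
    with * show "translate_equiv T S" unfolding translate_equiv_def by blast
  qed
  show "transp translate_equiv"
  proof (rule transpI)
    fix S T U assume *: "translate_equiv S T" "translate_equiv T U"
    then obtain k l where "\<forall>x. T x = S (x + k)" "\<forall>x. U x = T (x + l)"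
      by (auto simp: translate_equiv_def)
    then have "\<forall>x. U x = S (x + (l + k))" by (simp add: add.assoc)
    with * show "translate_equiv S U" unfolding translate_equiv_def by blast
  qed
qed

quotient_type conf = "int \<Rightarrow> bool" / partial: translate_equiv
  by (rule part_equivp_translate_equiv)

lift_definition ground :: conf is "\<lambda>x. x < 0"
  using config_ground by (auto simp: translate_equiv_def intro: exI[of _ 0])


section \<open>One step of the exclusion-voter dynamics\<close>

text \<open>The unlike pair at sites \<open>x\<close>, \<open>x + 1\<close> is represented by its left site \<open>x\<close>.\<close>

definition unlike_pairs :: "(int \<Rightarrow> bool) \<Rightarrow> int set" where
  "unlike_pairs S = {x. S x \<noteq> S (x + 1)}"

definition set_pair :: "(int \<Rightarrow> bool) \<Rightarrow> int \<Rightarrow> bool \<Rightarrow> bool \<Rightarrow> int \<Rightarrow> bool" where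
  "set_pair S x a b = S(x := a, x + 1 := b)"

definition voter_move :: "(int \<Rightarrow> bool) \<Rightarrow> int \<Rightarrow> (int \<Rightarrow> bool) pmf" where
  "voter_move S x = map_pmf (\<lambda>b. set_pair S x b b) (bernoulli_pmf (1 / 2))"

text \<open>On an unlike pair the label of the left site decides between 10 and 01.\<close>

definition exclusion_move :: "real \<Rightarrow> (int \<Rightarrow> bool) \<Rightarrow> int \<Rightarrow> (int \<Rightarrow> bool) pmf" where
  "exclusion_move p S x =
     (if S x
      then map_pmf (\<lambda>m. if m then set_pair S x False True else S) (bernoulli_pmf (1 - p))
      else map_pmf (\<lambda>m. if m then set_pair S x True False else S) (bernoulli_pmf p))"

definition step :: "real \<Rightarrow> real \<Rightarrow> (int \<Rightarrow> bool) \<Rightarrow> (int \<Rightarrow> bool) pmf" where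
  "step \<beta> p S =
     do {
       v \<leftarrow> bernoulli_pmf \<beta>;
       x \<leftarrow> pmf_of_set (unlike_pairs S);
       if v then voter_move S x else exclusion_move p S x
     }"

lemma finite_unlike_pairs:
  assumes "config S"
  shows "finite (unlike_pairs S)"
proof -
  let ?A = "{x. x < 0 \<and> \<not> S x}" and ?B = "{x. x > 0 \<and> S x}"
  have "unlike_pairs S \<subseteq> ?A \<union> ?B \<union> (\<lambda>x. x - 1) ` ?A \<union> (\<lambda>x. x - 1) ` ?B \<union> {-1, 0}"
  proof
    fix x assume "x \<in> unlike_pairs S"
    then have u: "S x \<noteq> S (x + 1)" by (simp add: unlike_pairs_def)
    have im: "x \<in> (\<lambda>x. x - 1) ` C" if "x + 1 \<in> C" for C :: "int set"
      using that by (intro image_eqI[of _ _ "x + 1"]) auto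
    consider "x < -1" | "x = -1" | "x = 0" | "x > 0" by linarith
    then show "x \<in> ?A \<union> ?B \<union> (\<lambda>x. x - 1) ` ?A \<union> (\<lambda>x. x - 1) ` ?B \<union> {-1, 0}"
    proof cases
      case 1
      then have "x \<in> ?A \<or> x + 1 \<in> ?A" using u by auto
      then show ?thesis using im[of ?A] by blast
    next
      case 4
      then have "x \<in> ?B \<or> x + 1 \<in> ?B" using u by auto
      then show ?thesis using im[of ?B] by blast
    qed auto
  qed
  then show ?thesis
    by (rule finite_subset) (use assms in \<open>simp add: config_def\<close>)
qed

lemma unlike_pairs_nonempty:
  assumes "config S"
  shows "unlike_pairs S \<noteq> {}"
proof
  assume "unlike_pairs S = {}"
  then have eq: "S (x + 1) = S x" for x by (auto simp: unlike_pairs_def)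
  have const: "S x = S 0" for x
  proof (induction x rule: int_induct[where k = 0])
    case (step2 i)
    then show ?case using eq[of "i - 1"] by simp
  qed (simp_all add: eq)
  show False
  proof (cases "S 0")
    case True
    then have "{x. x > 0 \<and> S x} = {0<..}" by (subst const) auto
    then show False using assms infinite_Ioi[of "0::int"] by (simp add: config_def)
  next
    case False
    then have "{x. x < 0 \<and> \<not> S x} = {..<0}" by (subst const) auto
    then show False using assms infinite_Iio[of "0::int"] by (simp add: config_def)
  qed
qed

lemma config_set_pair:
  assumes "config S"
  shows "config (set_pair S x a b)"
proof -
  have "{y. y < 0 \<and> \<not> set_pair S x a b y} \<subseteq> {y. y < 0 \<and> \<not> S y} \<union> {x, x + 1}"
    "{y. y > 0 \<and> set_pair S x a b y} \<subseteq> {y. y > 0 \<and> S y} \<union> {x, x + 1}"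
    by (auto simp: set_pair_def split: if_splits)
  then show ?thesis
    using assms unfolding config_def by (meson finite.emptyI finite.insertI finite_UnI finite_subset)
qed

lemma translate_equiv_set_pair:
  assumes "translate_equiv S T" "\<And>x. T x = S (x + k)"
  shows "translate_equiv (set_pair S (x + k) a b) (set_pair T x a b)"
proof -
  have "\<forall>y. set_pair T x a b y = set_pair S (x + k) a b (y + k)"
    using assms(2) by (auto simp: set_pair_def)
  then show ?thesis
    using assms(1) config_set_pair unfolding translate_equiv_def by blast
qed

text \<open>The obligation below says that the dynamics preserve the class of configurations and do not
  depend on the chosen representative.\<close>

lift_definition exclusion_voter_kernel :: "real \<Rightarrow> real \<Rightarrow> conf \<Rightarrow> conf pmf" is step
proof -
  fix \<beta> p :: real and S T
  assume *: "translate_equiv S T"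
  then obtain k where k: "\<And>x. T x = S (x + k)" by (auto simp: translate_equiv_def)
  have cT: "config T" using * by (simp add: translate_equiv_def)
  have im: "unlike_pairs S = (\<lambda>x. x + k) ` unlike_pairs T"
  proof (intro set_eqI iffI)
    fix x assume "x \<in> unlike_pairs S"
    then have "x - k \<in> unlike_pairs T" by (simp add: unlike_pairs_def k)
    then show "x \<in> (\<lambda>x. x + k) ` unlike_pairs T" by (intro image_eqI[of _ _ "x - k"]) auto
  qed (auto simp: unlike_pairs_def k algebra_simps)
  have site: "rel_pmf (\<lambda>x y. x = y + k) (pmf_of_set (unlike_pairs S)) (pmf_of_set (unlike_pairs T))"
  proof -
    have "pmf_of_set (unlike_pairs S) = map_pmf (\<lambda>x. x + k) (pmf_of_set (unlike_pairs T))"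
      unfolding im using cT finite_unlike_pairs unlike_pairs_nonempty
      by (intro map_pmf_of_set_inj[symmetric]) (auto simp: inj_on_def)
    then show ?thesis
      by (simp add: pmf.rel_map rel_pmf_reflI)
  qed
  note set_pair = translate_equiv_set_pair[OF * k]
  have "rel_pmf translate_equiv (voter_move S (x + k)) (voter_move T x)" for x
    unfolding voter_move_def pmf.rel_map by (intro rel_pmf_reflI set_pair)
  moreover have "rel_pmf translate_equiv (exclusion_move p S (x + k)) (exclusion_move p T x)" for x
    unfolding exclusion_move_def using k * by (auto simp: pmf.rel_map intro!: rel_pmf_reflI set_pair)
  ultimately show "rel_pmf translate_equiv (step \<beta> p S) (step \<beta> p T)"
    unfolding step_def
    by (intro rel_pmf_bindI[where R = "(=)"] rel_pmf_bindI[OF site]) (auto simp: pmf.rel_eq)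
qed


section \<open>The process and its relaxation time\<close>

text \<open>Time-homogeneous Markov chains on a countable state space, with an arbitrary initial law.\<close>

definition markov_chain :: "'a measure \<Rightarrow> ('s \<Rightarrow> 's pmf) \<Rightarrow> (nat \<Rightarrow> 'a \<Rightarrow> 's) \<Rightarrow> bool" where
  "markov_chain M K \<xi> \<longleftrightarrow>
     prob_space M \<and>
     (\<forall>t. \<xi> t \<in> measurable M (count_space UNIV)) \<and>
     (\<forall>t s y. \<P>(\<omega> in M. \<forall>i\<le>t. \<xi> i \<omega> = s i) > 0 \<longrightarrow>
        \<P>(\<omega> in M. \<xi> (Suc t) \<omega> = y \<bar> \<forall>i\<le>t. \<xi> i \<omega> = s i) = pmf (K (s t)) y)"

definition exclusion_voter_process ::
  "real \<Rightarrow> real \<Rightarrow> 'a measure \<Rightarrow> (nat \<Rightarrow> 'a \<Rightarrow> conf) \<Rightarrow> bool" where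
  "exclusion_voter_process \<beta> p M \<xi> \<longleftrightarrow> markov_chain M (exclusion_voter_kernel \<beta> p) \<xi>"

text \<open>The infimum of the empty set is \<open>\<infinity>\<close>.\<close>

definition relaxation_time :: "(nat \<Rightarrow> 'a \<Rightarrow> conf) \<Rightarrow> 'a \<Rightarrow> enat" where
  "relaxation_time \<xi> \<omega> = (INF t\<in>{t. 1 \<le> t \<and> \<xi> t \<omega> = ground}. enat t)"

text \<open>Powers with a positive real exponent.\<close>

definition enat_powr :: "enat \<Rightarrow> real \<Rightarrow> ennreal" where
  "enat_powr n a = (case n of enat m \<Rightarrow> ennreal (real m powr a) | \<infinity> \<Rightarrow> \<infinity>)"

end

theory Submission
  imports Defs
begin

text \<open>
  The claim follows from the lower bound \<open>P(\<tau> > k\<^sup>2) \<ge> \<delta> / k\<^sup>4\<close> for large \<open>k\<close>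
  (\<open>survival_tail\<close>): it gives a moment of order \<open>2 + \<epsilon>\<close> of at least \<open>\<delta> k\<^sup>2\<^sup>\<epsilon>\<close> for every
  large \<open>k\<close>. The bound is the product of two probabilities, with \<open>L\<close> of order \<open>k\<close>: about
  \<open>1 / L\<^sup>3\<close> for the configuration to survive for time \<open>k\<^sup>2\<close> or to spread before that over a distance
  \<open>5 L\<close>, and about \<open>1 / L\<close> for a configuration that is so wide to survive for time \<open>k\<^sup>2\<close>.

  The first factor comes from the cubic functional \<open>inversion_length\<close>, the sum of \<open>y - x\<close> over the
  pairs \<open>x < y\<close> with label 0 at \<open>x\<close> and label 1 at \<open>y\<close>. It vanishes exactly in the ground state, it is
  a martingale for voter moves, and a submartingale for exclusion moves because \<open>p \<le> 1/2\<close> does not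
  favour the repair of inversions (\<open>inversion_length_submartingale\<close>). It is at most of order \<open>L\<^sup>3\<close> until
  the configuration becomes wide (\<open>inversion_length_le\<close>), so that it can keep its mean only by
  surviving or by becoming wide with probability of order \<open>1 / L\<^sup>3\<close>.

  For the second factor, fix a site \<open>c\<close>. The configuration is alive as long as there are a 0 to the
  left of \<open>c\<close> and a 1 to the right of \<open>c\<close>. The numbers of such sites, each site weighted by its
  distance to \<open>c\<close> up to saturation at distance \<open>L\<close>, change by at most 1 per step and, up to a relative
  error of order \<open>1 / L\<^sup>2\<close>, do not decrease in mean. A concave function that saturates at \<open>L\<close> turns both into
  scores in \<open>[0, 1]\<close>, and a move changes only one of the two. Hence the mean of the product
  of the scores shrinks per step at most by a factor \<open>1 - O(1 / L\<^sup>2)\<close> (\<open>score_drift\<close>), and up to time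
  \<open>k\<^sup>2\<close> at most by a constant factor. In a wide configuration \<open>c\<close> can be chosen with many ones to the right and at least one zero far
  to the left, or the other way round; then the product is at least of order \<open>1 / L\<close>
  (\<open>wide_score_ge\<close>), and it bounds the survival probability from below.

  All weights used are monotone in the site, so the exclusion moves with \<open>p < 1/2\<close>, which push
  ones to the right and zeros to the left, only help, however far they spread the
  configuration.
\<close>

section \<open>Averaging over one step\<close>

text \<open>
  The mean of \<open>F\<close> after one step, given that the unlike pair at \<open>x\<close> was chosen.
\<close>

definition pair_mean ::
  "real \<Rightarrow> real \<Rightarrow> ((int \<Rightarrow> bool) \<Rightarrow> real) \<Rightarrow> (int \<Rightarrow> bool) \<Rightarrow> int \<Rightarrow> real" where
  "pair_mean \<beta> p F S x =
     \<beta> * ((F (set_pair S x False False) + F (set_pair S x True True)) / 2) +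
     (1 - \<beta>) * (if S x then (1 - p) * F (set_pair S x False True) + p * F S
                else p * F (set_pair S x True False) + (1 - p) * F S)"

lemma finite_set_voter_move: "finite (set_pmf (voter_move S x))"
  by (simp add: voter_move_def)

lemma finite_set_exclusion_move: "finite (set_pmf (exclusion_move p S x))"
  by (simp add: exclusion_move_def)

lemma finite_set_step:
  assumes "config S"
  shows "finite (set_pmf (step \<beta> p S))"
  using assms finite_unlike_pairs[OF assms] unlike_pairs_nonempty[OF assms]
  by (auto simp: step_def finite_set_voter_move finite_set_exclusion_move)

lemma set_step:
  assumes "config S" "T \<in> set_pmf (step \<beta> p S)"
  shows "T = S \<or> (\<exists>x\<in>unlike_pairs S. \<exists>a b. T = set_pair S x a b)"
  using assms finite_unlike_pairs[OF assms(1)] unlike_pairs_nonempty[OF assms(1)]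
  by (auto simp: step_def voter_move_def exclusion_move_def split: if_splits)

lemma config_step:
  assumes "config S" "T \<in> set_pmf (step \<beta> p S)"
  shows "config T"
  using set_step[OF assms] assms(1) config_set_pair by blast

lemma expectation_step:
  assumes "config S" "0 \<le> \<beta>" "\<beta> \<le> 1" "0 \<le> p" "p \<le> 1"
  shows "measure_pmf.expectation (step \<beta> p S) F =
           (\<Sum>x\<in>unlike_pairs S. pair_mean \<beta> p F S x) / card (unlike_pairs S)"
proof -
  let ?U = "unlike_pairs S"
  have U: "?U \<noteq> {}" "finite ?U"
    using assms(1) by (simp_all add: finite_unlike_pairs unlike_pairs_nonempty)
  have voter: "measure_pmf.expectation (voter_move S x) F =
      (F (set_pair S x False False) + F (set_pair S x True True)) / 2" for x
    by (simp add: voter_move_def integral_bernoulli_pmf add_divide_distrib)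
  have excl: "measure_pmf.expectation (exclusion_move p S x) F =
      (if S x then (1 - p) * F (set_pair S x False True) + p * F S
       else p * F (set_pair S x True False) + (1 - p) * F S)" for x
    using assms by (simp add: exclusion_move_def integral_bernoulli_pmf mult.commute)
  have "measure_pmf.expectation (step \<beta> p S) F =
      (\<Sum>v\<in>UNIV. pmf (bernoulli_pmf \<beta>) v *\<^sub>R measure_pmf.expectation
         (pmf_of_set ?U \<bind> (\<lambda>x. if v then voter_move S x else exclusion_move p S x)) F)"
    unfolding step_def
    by (rule pmf_expectation_bind)
      (use U in \<open>auto simp: finite_set_voter_move finite_set_exclusion_move\<close>)
  also have "\<dots> = \<beta> * measure_pmf.expectation (pmf_of_set ?U \<bind> voter_move S) F
      + (1 - \<beta>) * measure_pmf.expectation (pmf_of_set ?U \<bind> exclusion_move p S) F"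
    using assms by (simp add: UNIV_bool)
  also have "\<dots> = \<beta> * (\<Sum>x\<in>?U. measure_pmf.expectation (voter_move S x) F / card ?U)
      + (1 - \<beta>) * (\<Sum>x\<in>?U. measure_pmf.expectation (exclusion_move p S x) F / card ?U)"
    using U by (simp add: pmf_expectation_bind_pmf_of_set finite_set_voter_move
        finite_set_exclusion_move divide_inverse mult.commute)
  also have "\<dots> = (\<Sum>x\<in>?U. pair_mean \<beta> p F S x) / card ?U"
    unfolding voter excl pair_mean_def sum.distrib sum_divide_distrib[symmetric]
      sum_distrib_left[symmetric] by (simp add: add_divide_distrib distrib_left mult.commute)
  finally show ?thesis .
qed

text \<open>
  Multiplied by the number of unlike pairs, a drift is a plain sum over the pairs, which is the form
  in which all drifts below are computed.
\<close>

lemma expectation_step_ge: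
  fixes r :: real
  assumes "config S" "0 \<le> \<beta>" "\<beta> \<le> 1" "0 \<le> p" "p \<le> 1"
    and "r * card (unlike_pairs S) \<le> (\<Sum>x\<in>unlike_pairs S. pair_mean \<beta> p F S x)"
  shows "r \<le> measure_pmf.expectation (step \<beta> p S) F"
proof -
  have "card (unlike_pairs S) > 0"
    using assms(1) by (simp add: card_gt_0_iff finite_unlike_pairs unlike_pairs_nonempty)
  with assms show ?thesis by (simp add: expectation_step field_simps)
qed

section \<open>The ground state\<close>

lemma translate_equiv_refl: "config S \<Longrightarrow> translate_equiv S S"
  by (auto simp: translate_equiv_def intro: exI[of _ 0])

lemma abs_conf_eq_iff:
  assumes "config S" "config T"
  shows "abs_conf S = abs_conf T \<longleftrightarrow> translate_equiv S T"
  using Quotient3_rel[OF Quotient3_conf, of S T] assms by (auto simp: translate_equiv_refl)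

lemma conf_obtain_rep:
  obtains S where "config S" "abs_conf S = C"
proof -
  have "\<exists>S. config S \<and> abs_conf S = C"
    by (rule conf.abs_induct) (auto simp: translate_equiv_def)
  with that show ?thesis by blast
qed

lemma config_bounds:
  assumes "config S"
  shows "\<exists>lo hi. lo < hi \<and> (\<forall>x\<le>lo. S x) \<and> (\<forall>x\<ge>hi. \<not> S x)"
proof -
  let ?A = "{x. x < 0 \<and> \<not> S x}" and ?B = "{x. x > 0 \<and> S x}"
  have fin: "finite ?A" "finite ?B" using assms by (auto simp: config_def)
  obtain a where a: "\<And>x. x \<in> ?A \<Longrightarrow> a \<le> x"
    using bdd_below_finite[OF fin(1)] unfolding bdd_below_def by blast
  obtain b where b: "\<And>x. x \<in> ?B \<Longrightarrow> x \<le> b"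
    using bdd_above_finite[OF fin(2)] unfolding bdd_above_def by blast
  have "S x" if "x \<le> min a 0 - 1" for x
  proof (rule ccontr)
    assume "\<not> S x"
    with a[of x] that show False by simp
  qed
  moreover have "\<not> S x" if "x \<ge> max b 0 + 1" for x
  proof
    assume "S x"
    moreover have "0 < x" "b < x" using that by linarith+
    ultimately show False using b[of x] by simp
  qed
  ultimately show ?thesis
    by (intro exI[of _ "min a 0 - 1"] exI[of _ "max b 0 + 1"]) auto
qed

lemma abs_conf_eq_ground_iff:
  assumes "config S"
  shows "abs_conf S = ground \<longleftrightarrow> \<not> (\<exists>x y. x < y \<and> \<not> S x \<and> S y)"
proof
  assume "abs_conf S = ground"
  then have "translate_equiv S (\<lambda>x. x < 0)"
    using assms by (simp add: ground.abs_eq abs_conf_eq_iff config_ground)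
  then obtain k where k: "\<And>x. (x < 0) = S (x + k)" by (auto simp: translate_equiv_def)
  have S: "S y \<longleftrightarrow> y < k" for y using k[of "y - k"] by simp
  show "\<not> (\<exists>x y. x < y \<and> \<not> S x \<and> S y)"
  proof clarify
    fix x y assume "x < y" "\<not> S x" "S y"
    then show False using S[of x] S[of y] by linarith
  qed
next
  assume no_inversion: "\<not> (\<exists>x y. x < y \<and> \<not> S x \<and> S y)"
  obtain lo hi where b: "lo < hi" "\<forall>x\<le>lo. S x" "\<forall>x\<ge>hi. \<not> S x"
    using config_bounds[OF assms] by blast
  let ?A = "{y. lo \<le> y \<and> y \<le> hi \<and> S y}"
  have fin: "finite ?A"
    by (rule finite_subset[of _ "{lo..hi}"]) auto
  have lo: "lo \<in> ?A" using b by auto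
  define m where "m = Max ?A"
  have m: "S m"
    using Max_in[OF fin] lo unfolding m_def by blast
  have le: "y \<le> m" if "S y" for y
  proof (cases "y \<le> lo")
    case True
    then show ?thesis using Max_ge[OF fin lo] unfolding m_def by linarith
  next
    case False
    then have "y \<in> ?A" using b(3) that by (cases "y \<le> hi") auto
    then show ?thesis using Max_ge[OF fin] unfolding m_def by blast
  qed
  have S: "S y \<longleftrightarrow> y < m + 1" for y
  proof
    assume "S y"
    then show "y < m + 1" using le[of y] by simp
  next
    assume "y < m + 1"
    then have "y = m \<or> y < m" by linarith
    then show "S y" using m no_inversion by blast
  qed
  have "translate_equiv S (\<lambda>x. x < 0)"
    unfolding translate_equiv_def using assms config_ground
    by (intro conjI exI[of _ "m + 1"] allI) (auto simp: S)
  then show "abs_conf S = ground"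
    using assms by (simp add: ground.abs_eq abs_conf_eq_iff config_ground)
qed

section \<open>Survival probabilities\<close>

text \<open>
  The probability that a chain started in \<open>C\<close> avoids the ground state at the times \<open>0, \<dots>, n\<close>,
  by first-step analysis.
\<close>

fun survival :: "real \<Rightarrow> real \<Rightarrow> nat \<Rightarrow> conf \<Rightarrow> real" where
  "survival \<beta> p 0 C = (if C = ground then 0 else 1)"
| "survival \<beta> p (Suc n) C =
     (if C = ground then 0
      else measure_pmf.expectation (exclusion_voter_kernel \<beta> p C) (survival \<beta> p n))"

lemma survival_ground [simp]: "survival \<beta> p n ground = 0"
  by (cases n) simp_all

lemma kernel_abs_conf:
  assumes "config S"
  shows "exclusion_voter_kernel \<beta> p (abs_conf S) = map_pmf abs_conf (step \<beta> p S)"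
  using assms by (simp add: exclusion_voter_kernel.abs_eq translate_equiv_refl)

lemma finite_set_kernel: "finite (set_pmf (exclusion_voter_kernel \<beta> p C))"
  by (rule conf_obtain_rep[of C]) (auto simp: kernel_abs_conf finite_set_step)

lemma survival_Suc_rep:
  assumes "config S" "abs_conf S \<noteq> ground"
  shows "survival \<beta> p (Suc n) (abs_conf S) =
           measure_pmf.expectation (step \<beta> p S) (\<lambda>T. survival \<beta> p n (abs_conf T))"
  using assms by (simp add: kernel_abs_conf)

lemma expectation_step_mono:
  assumes "config S" "\<And>T. T \<in> set_pmf (step \<beta> p S) \<Longrightarrow> F T \<le> (G T :: real)"
  shows "measure_pmf.expectation (step \<beta> p S) F \<le> measure_pmf.expectation (step \<beta> p S) G"
  by (rule integral_mono_AE)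
    (use assms in \<open>auto simp: AE_measure_pmf_iff finite_set_step intro!: integrable_measure_pmf_finite\<close>)

text \<open>
  Killing the chain in the ground state can only increase the mean of a function that is nonpositive
  there, so a bounded function with a controlled relative drift is a lower bound for the survival
  probability.
\<close>

lemma survival_ge:
  assumes "config S"
    and "\<And>S. config S \<Longrightarrow> h S \<le> 1"
    and "\<And>S. config S \<Longrightarrow> abs_conf S = ground \<Longrightarrow> h S \<le> 0"
    and "\<And>S. config S \<Longrightarrow> abs_conf S \<noteq> ground \<Longrightarrow>
            \<rho> * h S \<le> measure_pmf.expectation (step \<beta> p S) h"
    and "0 \<le> \<rho>"
  shows "\<rho> ^ n * h S \<le> survival \<beta> p n (abs_conf S)"
  using assms(1)
proof (induction n arbitrary: S)
  case 0
  then show ?case using assms(2,3) by simp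
next
  case (Suc n)
  show ?case
  proof (cases "abs_conf S = ground")
    case True
    then show ?thesis
      using assms(3)[OF Suc.prems] assms(5)
      by (simp add: mult_nonneg_nonpos)
  next
    case False
    have "\<rho> ^ Suc n * h S \<le> \<rho> ^ n * measure_pmf.expectation (step \<beta> p S) h"
      using assms(4)[OF Suc.prems False] assms(5)
      by (simp add: mult.assoc mult.left_commute[of \<rho>] mult_left_mono)
    also have "\<dots> = measure_pmf.expectation (step \<beta> p S) (\<lambda>T. \<rho> ^ n * h T)"
      by simp
    also have "\<dots> \<le> measure_pmf.expectation (step \<beta> p S) (\<lambda>T. survival \<beta> p n (abs_conf T))"
      using Suc.IH config_step[OF Suc.prems]
      by (intro expectation_step_mono Suc.prems) blast
    finally show ?thesis using Suc.prems False by (simp add: survival_Suc_rep del: survival.simps)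
  qed
qed

text \<open>
  The first-step recursion is a lower bound for the actual chain because the kernel has finite
  support: the event splits over the finitely many possible next states.
\<close>

lemma markov_chain_survival:
  assumes "exclusion_voter_process \<beta> p M \<xi>"
  shows "\<P>(\<omega> in M. \<forall>i\<le>t. \<xi> i \<omega> = s i) * survival \<beta> p n (s t)
    \<le> \<P>(\<omega> in M. (\<forall>i\<le>t. \<xi> i \<omega> = s i) \<and> (\<forall>i. t < i \<and> i \<le> t + n \<longrightarrow> \<xi> i \<omega> \<noteq> ground))"
proof (induction n arbitrary: t s)
  case 0
  have none: "(\<forall>i. t < i \<and> i \<le> t \<longrightarrow> P i) = True" for P by auto
  show ?case by (simp add: none)
next
  case (Suc n)
  interpret prob_space M using assms by (simp add: exclusion_voter_process_def markov_chain_def)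
  have [measurable]: "\<xi> i \<in> measurable M (count_space UNIV)" for i
    using assms by (simp add: exclusion_voter_process_def markov_chain_def)
  let ?K = "exclusion_voter_kernel \<beta> p (s t)"
  let ?path = "\<P>(\<omega> in M. \<forall>i\<le>t. \<xi> i \<omega> = s i)"
  define s' where "s' y = s(Suc t := y)" for y
  let ?ev = "\<lambda>y. {\<omega>\<in>space M. (\<forall>i\<le>Suc t. \<xi> i \<omega> = s' y i) \<and>
      (\<forall>i. Suc t < i \<and> i \<le> Suc t + n \<longrightarrow> \<xi> i \<omega> \<noteq> ground)}"
  let ?Y = "set_pmf ?K - {ground}"
  have path_ext: "(\<forall>i\<le>Suc t. \<xi> i \<omega> = s' y i) \<longleftrightarrow> \<xi> (Suc t) \<omega> = y \<and> (\<forall>i\<le>t. \<xi> i \<omega> = s i)"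
    for \<omega> y
    by (auto simp: s'_def le_Suc_eq)
  have finY: "finite ?Y" by (simp add: finite_set_kernel)
  have ev_meas: "?ev y \<in> events" for y by measurable
  have one_step: "?path * pmf ?K y = \<P>(\<omega> in M. \<forall>i\<le>Suc t. \<xi> i \<omega> = s' y i)" for y
  proof (cases "?path > 0")
    case True
    then have "\<P>(\<omega> in M. \<xi> (Suc t) \<omega> = y \<bar> \<forall>i\<le>t. \<xi> i \<omega> = s i) = pmf ?K y"
      using assms unfolding exclusion_voter_process_def markov_chain_def by blast
    then show ?thesis using True by (simp add: cond_prob_def path_ext field_simps)
  next
    case False
    then have z: "?path = 0" by (simp add: zero_less_measure_iff)
    have "\<P>(\<omega> in M. \<forall>i\<le>Suc t. \<xi> i \<omega> = s' y i) \<le> ?path"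
      unfolding path_ext by (intro finite_measure_mono) auto
    then have "\<P>(\<omega> in M. \<forall>i\<le>Suc t. \<xi> i \<omega> = s' y i) = 0"
      unfolding z by (rule order_antisym) simp
    then show ?thesis using z by simp
  qed
  show ?case
  proof (cases "s t = ground")
    case True
    then show ?thesis by simp
  next
    case False
    have "?path * survival \<beta> p (Suc n) (s t) = ?path * (\<Sum>y\<in>?Y. pmf ?K y * survival \<beta> p n y)"
      using False by (subst survival.simps, subst integral_measure_pmf[of ?Y])
        (auto simp: finite_set_kernel)
    also have "\<dots> = (\<Sum>y\<in>?Y. \<P>(\<omega> in M. \<forall>i\<le>Suc t. \<xi> i \<omega> = s' y i) * survival \<beta> p n (s' y (Suc t)))"
      by (simp only: sum_distrib_left mult.assoc[symmetric] one_step) (simp add: s'_def)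
    also have "\<dots> \<le> (\<Sum>y\<in>?Y. prob (?ev y))"
      by (intro sum_mono Suc.IH)
    also have "\<dots> = prob (\<Union>y\<in>?Y. ?ev y)"
      using ev_meas finY by (intro finite_measure_finite_Union[symmetric])
        (auto simp: disjoint_family_on_def s'_def)
    also have "\<dots> \<le> \<P>(\<omega> in M. (\<forall>i\<le>t. \<xi> i \<omega> = s i) \<and>
        (\<forall>i. t < i \<and> i \<le> t + Suc n \<longrightarrow> \<xi> i \<omega> \<noteq> ground))"
    proof (rule finite_measure_mono)
      show "(\<Union>y\<in>?Y. ?ev y) \<subseteq> {\<omega>\<in>space M. (\<forall>i\<le>t. \<xi> i \<omega> = s i) \<and>
        (\<forall>i. t < i \<and> i \<le> t + Suc n \<longrightarrow> \<xi> i \<omega> \<noteq> ground)}"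
        unfolding path_ext by (auto simp: less_Suc_eq_le) (metis Suc_lessI)
    qed measurable
    finally show ?thesis .
  qed
qed

section \<open>Weighted numbers of ones and of zeros\<close>

text \<open>
  Restricting the sum to nonzero weights makes it finite for every configuration when \<open>w\<close> vanishes far
  to the left.
\<close>

definition ones_weight :: "(int \<Rightarrow> real) \<Rightarrow> (int \<Rightarrow> bool) \<Rightarrow> real" where
  "ones_weight w S = (\<Sum>y\<in>{y. w y \<noteq> 0 \<and> S y}. w y)"

lemma finite_ones:
  assumes "config S" "\<And>y. y \<le> c \<Longrightarrow> w y = (0::real)"
  shows "finite {y. w y \<noteq> 0 \<and> S y}"
proof -
  obtain lo hi where hi: "\<forall>x\<ge>hi. \<not> S x" using config_bounds[OF assms(1)] by blast
  have "{y. w y \<noteq> 0 \<and> S y} \<subseteq> {c..hi}"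
  proof
    fix y assume "y \<in> {y. w y \<noteq> 0 \<and> S y}"
    then have "\<not> y \<le> c" "\<not> hi \<le> y" using assms(2) hi by auto
    then show "y \<in> {c..hi}" by simp
  qed
  then show ?thesis by (rule finite_subset) simp
qed

lemma ones_weight_eq_sum:
  assumes "finite A" "{y. w y \<noteq> 0 \<and> S y} \<subseteq> A"
  shows "ones_weight w S = (\<Sum>y\<in>A. of_bool (S y) * w y)"
  unfolding ones_weight_def using assms by (intro sum.mono_neutral_cong_left) auto

lemma ones_weight_set_pair:
  assumes "config S" "\<And>y. y \<le> c \<Longrightarrow> w y = 0"
  shows "ones_weight w (set_pair S x a b) = ones_weight w S
    + (of_bool a - of_bool (S x)) * w x + (of_bool b - of_bool (S (x + 1))) * w (x + 1)"
proof -
  define B where "B = {y. w y \<noteq> 0 \<and> S y} - {x, x + 1}"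
  let ?A = "insert x (insert (x + 1) B)"
  have B: "finite B" "x \<notin> B" "x + 1 \<notin> B"
    using finite_ones[OF assms] by (auto simp: B_def)
  have 1: "ones_weight w (set_pair S x a b) = (\<Sum>y\<in>?A. of_bool (set_pair S x a b y) * w y)"
    by (rule ones_weight_eq_sum) (use B in \<open>auto simp: B_def set_pair_def split: if_splits\<close>)
  have 2: "ones_weight w S = (\<Sum>y\<in>?A. of_bool (S y) * w y)"
    by (rule ones_weight_eq_sum) (use B in \<open>auto simp: B_def\<close>)
  have 3: "(\<Sum>y\<in>B. of_bool (set_pair S x a b y) * w y) = (\<Sum>y\<in>B. of_bool (S y) * w y)"
    using B by (intro sum.cong) (auto simp: set_pair_def)
  have 4: "set_pair S x a b x = a" "set_pair S x a b (x + 1) = b"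
    by (simp_all add: set_pair_def)
  have "ones_weight w (set_pair S x a b) =
      of_bool a * w x + (of_bool b * w (x + 1) + (\<Sum>y\<in>B. of_bool (S y) * w y))"
    unfolding 1 3[symmetric] using B by (simp add: 4 del: sum_of_bool_mult_eq)
  moreover have "ones_weight w S =
      of_bool (S x) * w x + (of_bool (S (x + 1)) * w (x + 1) + (\<Sum>y\<in>B. of_bool (S y) * w y))"
    unfolding 2 using B by (simp del: sum_of_bool_mult_eq)
  ultimately show ?thesis by (simp add: algebra_simps del: sum_of_bool_mult_eq)
qed

lemma ones_weight_nonneg:
  assumes "\<And>y. w y \<ge> 0"
  shows "ones_weight w S \<ge> 0"
  unfolding ones_weight_def by (intro sum_nonneg assms)

lemma sum_le_ones_weight:
  assumes "config S" "\<And>y. y \<le> c \<Longrightarrow> w y = 0" "\<And>y. w y \<ge> 0" "\<And>y. y \<in> A \<Longrightarrow> S y" "finite A"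
  shows "(\<Sum>y\<in>A. w y) \<le> ones_weight w S"
proof -
  have "(\<Sum>y\<in>A. w y) = (\<Sum>y\<in>{y\<in>A. w y \<noteq> 0}. w y)"
    using assms(5) by (intro sum.mono_neutral_right) auto
  also have "\<dots> \<le> ones_weight w S"
    unfolding ones_weight_def
    by (rule sum_mono2[OF finite_ones[OF assms(1,2)]]) (use assms(3,4) in auto)
  finally show ?thesis .
qed

lemma weight_le_ones_weight:
  assumes "config S" "\<And>y. y \<le> c \<Longrightarrow> w y = 0" "\<And>y. w y \<ge> 0" "S y"
  shows "w y \<le> ones_weight w S"
  using sum_le_ones_weight[OF assms(1-3), where A = "{y}"] assms(4) by simp

text \<open>
  Reflection of the line combined with the exchange of the labels maps configurations to
  configurations and leaves the dynamics invariant: the pair 10 stays 10. It turns statements about ones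
  on the right into statements about zeros on the left.
\<close>

definition reflect :: "(int \<Rightarrow> bool) \<Rightarrow> int \<Rightarrow> bool" where
  "reflect S = (\<lambda>x. \<not> S (- x))"

lemma uminus_image_Collect: "uminus ` {x. P x} = {x::int. P (- x)}"
proof (intro set_eqI iffI)
  fix x assume "x \<in> {x. P (- x)}"
  then show "x \<in> uminus ` {x. P x}" by (intro image_eqI[of _ _ "- x"]) auto
qed auto

lemma config_reflect:
  assumes "config S"
  shows "config (reflect S)"
proof -
  have "{x. x < 0 \<and> \<not> reflect S x} = uminus ` {x. x > 0 \<and> S x}"
    "{x. x > 0 \<and> reflect S x} = uminus ` {x. x < 0 \<and> \<not> S x}"
    by (simp_all add: reflect_def uminus_image_Collect)
  then show ?thesis using assms by (simp add: config_def)
qed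

lemma reflect_set_pair: "reflect (set_pair S x a b) = set_pair (reflect S) (- x - 1) (\<not> b) (\<not> a)"
  by (auto simp: reflect_def set_pair_def fun_eq_iff)

lemma pair_mean_reflect:
  assumes "x \<in> unlike_pairs S"
  shows "pair_mean \<beta> p (\<lambda>T. F (reflect T)) S x = pair_mean \<beta> p F (reflect S) (- x - 1)"
proof -
  have "reflect S (- x - 1) = (\<not> S (x + 1))" by (simp add: reflect_def add.commute)
  then have "reflect S (- x - 1) = S x" using assms by (simp add: unlike_pairs_def)
  then show ?thesis by (simp add: pair_mean_def reflect_set_pair add.commute)
qed

lemma unlike_pairs_reflect: "unlike_pairs (reflect S) = (\<lambda>x. - x - 1) ` unlike_pairs S"
proof (intro set_eqI iffI)
  fix x assume "x \<in> unlike_pairs (reflect S)"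
  then have "- x - 1 \<in> unlike_pairs S" by (auto simp: unlike_pairs_def reflect_def add.commute)
  then show "x \<in> (\<lambda>x. - x - 1) ` unlike_pairs S" by (intro image_eqI[of _ _ "- x - 1"]) auto
next
  fix x assume "x \<in> (\<lambda>x. - x - 1) ` unlike_pairs S"
  then obtain z where "z \<in> unlike_pairs S" "x = - z - 1" by blast
  then show "x \<in> unlike_pairs (reflect S)"
    by (auto simp: unlike_pairs_def reflect_def add.commute)
qed

lemma sum_pair_mean_reflect:
  "(\<Sum>x\<in>unlike_pairs S. pair_mean \<beta> p (\<lambda>T. F (reflect T)) S x)
     = (\<Sum>x\<in>unlike_pairs (reflect S). pair_mean \<beta> p F (reflect S) x)"
  by (simp add: unlike_pairs_reflect sum.reindex inj_on_def pair_mean_reflect)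

lemma card_unlike_pairs_reflect: "card (unlike_pairs (reflect S)) = card (unlike_pairs S)"
  by (simp add: unlike_pairs_reflect card_image inj_on_def)

lemma pair_mean_sum:
  "pair_mean \<beta> p (\<lambda>T. \<Sum>c\<in>A. F c T) S x = (\<Sum>c\<in>A. pair_mean \<beta> p (F c) S x)"
  by (cases "S x") (simp_all only: pair_mean_def if_True if_False sum.distrib[symmetric]
      sum_distrib_left sum_divide_distrib)

lemma pair_mean_mono:
  assumes "0 \<le> \<beta>" "\<beta> \<le> 1" "0 \<le> p" "p \<le> 1"
    and "\<And>a b. F (set_pair S x a b) \<le> G (set_pair S x a b)" "F S \<le> G S"
  shows "pair_mean \<beta> p F S x \<le> pair_mean \<beta> p G S x"
  unfolding pair_mean_def
  by (cases "S x"; simp only: if_True if_False)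
    (intro add_mono mult_left_mono divide_right_mono assms; use assms in simp)+

lemma pair_mean_affine:
  "pair_mean \<beta> p (\<lambda>T. d + m * G T) S x = d + m * pair_mean \<beta> p G S x"
  by (cases "S x") (simp_all add: pair_mean_def field_simps)

text \<open>
  In the mean, a voter move and a symmetric exclusion move have the same effect on a linear
  functional. The asymmetry for \<open>p < 1/2\<close> moves ones to the right, towards larger weights.
\<close>

lemma ones_weight_drift:
  assumes "config S" "\<And>y. y \<le> c \<Longrightarrow> w y = 0" "w x \<le> w (x + 1)" "x \<in> unlike_pairs S"
    and "\<beta> \<le> 1" "p \<le> 1 / 2"
  shows "pair_mean \<beta> p (ones_weight w) S x \<ge> ones_weight w S
    + (of_bool (S x) - of_bool (S (x + 1))) * (w (x + 1) - w x) / 2"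
proof -
  have upd: "ones_weight w (set_pair S x a b) = ones_weight w S
    + (of_bool a - of_bool (S x)) * w x + (of_bool b - of_bool (S (x + 1))) * w (x + 1)" for a b
    by (rule ones_weight_set_pair) (use assms in auto)
  have "(1 - \<beta>) * ((1 - 2 * p) * (w (x + 1) - w x)) \<ge> 0"
    using assms by simp
  then show ?thesis
    using assms(4) unfolding pair_mean_def upd
    by (cases "S x") (simp_all add: unlike_pairs_def field_simps)
qed

lemma summation_by_parts:
  fixes s g :: "int \<Rightarrow> real"
  assumes "lo \<le> hi"
  shows "(\<Sum>x\<in>{lo..<hi}. (s x - s (x + 1)) * g x)
    = s lo * g lo - s hi * g hi + (\<Sum>x\<in>{lo..<hi}. s (x + 1) * (g (x + 1) - g x))"
  using assms
proof (induction hi rule: int_ge_induct)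
  case (step hi)
  have "{lo..<hi + 1} = insert hi {lo..<hi}" using step by auto
  then show ?case using step by (simp add: algebra_simps)
qed simp

text \<open>
  Summing the drift \<open>g\<close> of the pairs with their orientation turns it into a sum of the discrete
  derivative of \<open>g\<close> over the ones: first differences of a weight become its discrete Laplacian.
\<close>

lemma sum_unlike_pairs_by_parts:
  fixes g :: "int \<Rightarrow> real"
  assumes "lo < hi" "\<forall>x\<le>lo. S x" "\<forall>x\<ge>hi. \<not> S x"
  shows "(\<Sum>x\<in>unlike_pairs S. (of_bool (S x) - of_bool (S (x + 1))) * g x)
    = g lo + (\<Sum>x\<in>{lo..<hi}. of_bool (S (x + 1)) * (g (x + 1) - g x))"
proof -
  have "x \<in> {lo..<hi}" if "x \<in> unlike_pairs S" for x
  proof (rule ccontr)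
    assume "x \<notin> {lo..<hi}"
    then have "x + 1 \<le> lo \<or> x \<ge> hi" by auto
    then have "S x = S (x + 1)" using assms by auto
    with that show False by (simp add: unlike_pairs_def)
  qed
  then have "(\<Sum>x\<in>unlike_pairs S. (of_bool (S x) - of_bool (S (x + 1))) * g x)
     = (\<Sum>x\<in>{lo..<hi}. (of_bool (S x) - of_bool (S (x + 1))) * g x)"
    by (intro sum.mono_neutral_left) (auto simp: unlike_pairs_def)
  then show ?thesis
    using summation_by_parts[of lo hi "\<lambda>x. of_bool (S x)" g] assms by simp
qed

section \<open>The total length of the inversions\<close>

definition zeros_upto :: "int \<Rightarrow> (int \<Rightarrow> bool) \<Rightarrow> real" where
  "zeros_upto c S = ones_weight (\<lambda>y. of_bool (- c \<le> y)) (reflect S)"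

definition ones_after :: "int \<Rightarrow> (int \<Rightarrow> bool) \<Rightarrow> real" where
  "ones_after c S = ones_weight (\<lambda>y. of_bool (c < y)) S"

text \<open>
  An inversion \<open>(x, y)\<close>, that is \<open>x < y\<close> with label 0 at \<open>x\<close> and label 1 at \<open>y\<close>, is counted once for
  every \<open>c\<close> with \<open>x \<le> c < y\<close>, so this is the sum of \<open>y - x\<close> over all inversions. The form as a sum of
  products is convenient because a move at \<open>x\<close> can change both factors only for \<open>c = x\<close>.
\<close>

definition inversion_length :: "(int \<Rightarrow> bool) \<Rightarrow> real" where
  "inversion_length S =
     (\<Sum>c\<in>{c. zeros_upto c S * ones_after c S \<noteq> 0}. zeros_upto c S * ones_after c S)"

lemma ones_after_card: "ones_after c S = card {y. c < y \<and> S y}"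
proof -
  have "{y. of_bool (c < y) \<noteq> (0::real) \<and> S y} = {y. c < y \<and> S y}" by auto
  then show ?thesis by (simp add: ones_after_def ones_weight_def)
qed

lemma zeros_upto_card: "zeros_upto c S = card {x. x \<le> c \<and> \<not> S x}"
proof -
  have "zeros_upto c S = card {y. - c \<le> y \<and> reflect S y}"
  proof -
    have "(\<lambda>y. of_bool (- c \<le> y)) = (\<lambda>y. of_bool (- c - 1 < y) :: real)"
      "{y. - c \<le> y \<and> reflect S y} = {y. - c - 1 < y \<and> reflect S y}"
      by (auto simp: fun_eq_iff)
    then show ?thesis
      using ones_after_card[of "- c - 1" "reflect S"]
      by (simp only: zeros_upto_def ones_after_def)
  qed
  also have "{y. - c \<le> y \<and> reflect S y} = uminus ` {x. x \<le> c \<and> \<not> S x}"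
    by (auto simp: reflect_def uminus_image_Collect)
  finally show ?thesis by (simp add: card_image)
qed

lemma finite_ones_after:
  assumes "config S" shows "finite {y. c < y \<and> S y}"
proof -
  have "{y. of_bool (c < y) \<noteq> (0::real) \<and> S y} = {y. c < y \<and> S y}" by auto
  then show ?thesis
    using finite_ones[OF assms, of c "\<lambda>y. of_bool (c < y)"] by simp
qed

lemma finite_zeros_upto:
  assumes "config S" shows "finite {x. x \<le> c \<and> \<not> S x}"
proof -
  have "{x. x \<le> c \<and> \<not> S x} = uminus ` {y. - c - 1 < y \<and> reflect S y}"
    by (auto simp: reflect_def uminus_image_Collect)
  then show ?thesis using finite_ones_after[OF config_reflect[OF assms]] by simp
qed

lemma zeros_upto_nonneg [simp]: "zeros_upto c S \<ge> 0"
  by (simp add: zeros_upto_card)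

lemma ones_after_nonneg [simp]: "ones_after c S \<ge> 0"
  by (simp add: ones_after_card)

lemma zeros_upto_ne_0_iff:
  assumes "config S" shows "zeros_upto c S \<noteq> 0 \<longleftrightarrow> (\<exists>x\<le>c. \<not> S x)"
  using finite_zeros_upto[OF assms] by (auto simp: zeros_upto_card)

lemma ones_after_ne_0_iff:
  assumes "config S" shows "ones_after c S \<noteq> 0 \<longleftrightarrow> (\<exists>y>c. S y)"
  using finite_ones_after[OF assms] by (auto simp: ones_after_card)

lemma ones_after_Suc:
  assumes "config S" shows "ones_after (c + 1) S = ones_after c S - of_bool (S (c + 1))"
proof (cases "S (c + 1)")
  case True
  then have "c < y \<and> S y \<longleftrightarrow> y = c + 1 \<or> (c + 1 < y \<and> S y)" for y
    by (cases "y = c + 1") auto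
  then have "{y. c < y \<and> S y} = insert (c + 1) {y. c + 1 < y \<and> S y}" by blast
  then show ?thesis using finite_ones_after[OF assms] True by (simp add: ones_after_card)
next
  case False
  then have "c < y \<and> S y \<longleftrightarrow> c + 1 < y \<and> S y" for y
    by (cases "y = c + 1") auto
  then show ?thesis using False by (simp add: ones_after_card)
qed

lemma zeros_upto_Suc:
  assumes "config S" shows "zeros_upto (c + 1) S = zeros_upto c S + of_bool (\<not> S (c + 1))"
proof (cases "S (c + 1)")
  case False
  then have "y \<le> c + 1 \<and> \<not> S y \<longleftrightarrow> y = c + 1 \<or> (y \<le> c \<and> \<not> S y)" for y
    by (cases "y = c + 1") auto
  then have "{y. y \<le> c + 1 \<and> \<not> S y} = insert (c + 1) {y. y \<le> c \<and> \<not> S y}" by blast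
  then show ?thesis using finite_zeros_upto[OF assms] False by (simp add: zeros_upto_card)
next
  case True
  then have "y \<le> c + 1 \<and> \<not> S y \<longleftrightarrow> y \<le> c \<and> \<not> S y" for y
    by (cases "y = c + 1") auto
  then show ?thesis using True by (simp add: zeros_upto_card)
qed

lemma ones_after_set_pair:
  assumes "config S"
  shows "ones_after c (set_pair S x a b) = ones_after c S
    + (of_bool a - of_bool (S x)) * of_bool (c < x)
    + (of_bool b - of_bool (S (x + 1))) * of_bool (c < x + 1)"
  unfolding ones_after_def by (rule ones_weight_set_pair[OF assms, of c]) auto

lemma zeros_upto_set_pair:
  assumes "config S"
  shows "zeros_upto c (set_pair S x a b) = zeros_upto c S
    + (of_bool (S x) - of_bool a) * of_bool (x \<le> c)
    + (of_bool (S (x + 1)) - of_bool b) * of_bool (x + 1 \<le> c)"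
  unfolding zeros_upto_def reflect_set_pair
  by (subst ones_weight_set_pair[OF config_reflect[OF assms], of "- c - 1"])
    (auto simp: reflect_def add.commute)

lemma inversion_length_eq_sum:
  assumes "config S" "\<forall>x<lo. S x" "\<forall>x>hi. \<not> S x"
  shows "inversion_length S = (\<Sum>c\<in>{lo..<hi}. zeros_upto c S * ones_after c S)"
  unfolding inversion_length_def
proof (rule sum.mono_neutral_left)
  show "{c. zeros_upto c S * ones_after c S \<noteq> 0} \<subseteq> {lo..<hi}"
  proof
    fix c assume "c \<in> {c. zeros_upto c S * ones_after c S \<noteq> 0}"
    then obtain x y where "x \<le> c" "\<not> S x" "c < y" "S y"
      using zeros_upto_ne_0_iff[OF assms(1)] ones_after_ne_0_iff[OF assms(1)] by auto
    then have "\<not> x < lo" "\<not> y > hi" using assms by auto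
    then show "c \<in> {lo..<hi}" using \<open>x \<le> c\<close> \<open>c < y\<close> by simp
  qed
qed auto

text \<open>
  For \<open>c \<noteq> x\<close> only one factor can change, and its change has mean zero. For \<open>c = x\<close> the voter part
  gives the bound with equality, and exclusion satisfies it because \<open>p \<le> 1/2\<close>.
\<close>

lemma pair_mean_zeros_times_ones:
  assumes "config S" "x \<in> unlike_pairs S" "0 \<le> \<beta>" "\<beta> \<le> 1" "0 \<le> p" "p \<le> 1 / 2"
  shows "zeros_upto c S * ones_after c S
      + (if c = x then (of_bool (S x) - of_bool (S (x + 1))) * (zeros_upto x S + ones_after x S) / 2
         else 0)
    \<le> pair_mean \<beta> p (\<lambda>T. zeros_upto c T * ones_after c T) S x"
proof -
  let ?L = "zeros_upto c S" and ?R = "ones_after c S"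
  note upd = zeros_upto_set_pair[OF assms(1)] ones_after_set_pair[OF assms(1)]
  consider "c < x" | "c > x" | "c = x" by linarith
  then show ?thesis
  proof cases
    case 3
    show ?thesis
    proof (cases "S x")
      case True
      have "0 \<le> (1 - \<beta>) * ((1 - p) * (?L + ?R + 1) - (?L + ?R) / 2)"
      proof (intro mult_nonneg_nonneg)
        have "(?L + ?R) / 2 \<le> (1 - p) * (?L + ?R)"
          using mult_right_mono[of "1 / 2" "1 - p" "?L + ?R"] assms by simp
        then show "0 \<le> (1 - p) * (?L + ?R + 1) - (?L + ?R) / 2"
          using assms by (simp add: distrib_left)
      qed (use assms in simp)
      then show ?thesis
        using assms(2) 3 True by (simp add: pair_mean_def upd unlike_pairs_def field_simps)
    next
      case False
      have "0 \<le> (1 - \<beta>) * ((?L + ?R) / 2 - p * (?L + ?R - 1))"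
      proof (intro mult_nonneg_nonneg)
        have "p * (?L + ?R) \<le> (?L + ?R) / 2"
          using mult_right_mono[of p "1 / 2" "?L + ?R"] assms by simp
        then show "0 \<le> (?L + ?R) / 2 - p * (?L + ?R - 1)"
          using assms by (simp add: right_diff_distrib)
      qed (use assms in simp)
      then show ?thesis
        using assms(2) 3 False by (simp add: pair_mean_def upd unlike_pairs_def field_simps)
    qed
  qed (use assms(2) in \<open>auto simp: pair_mean_def upd unlike_pairs_def field_simps\<close>)
qed

text \<open>
  The lower bounds for the drifts of the individual pairs add up to zero by summation by parts: from one site to the
  next, the number of zeros on the left plus the number of ones on the right changes by 1 or -1
  according to the label, and the resulting sum cancels against the boundary term.
\<close>

lemma inversion_length_submartingale:
  assumes "config S" "0 \<le> \<beta>" "\<beta> \<le> 1" "0 \<le> p" "p \<le> 1 / 2"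
  shows "inversion_length S \<le> measure_pmf.expectation (step \<beta> p S) inversion_length"
proof (rule expectation_step_ge)
  let ?U = "unlike_pairs S"
  obtain lo hi where b: "lo < hi" "\<forall>x\<le>lo. S x" "\<forall>x\<ge>hi. \<not> S x"
    using config_bounds[OF assms(1)] by blast
  let ?A = "\<lambda>x. zeros_upto x S + ones_after x S"
  let ?F = "\<lambda>c T. zeros_upto c T * ones_after c T"
  have window: "x \<in> {lo..<hi}" if "x \<in> ?U" for x
  proof (rule ccontr)
    assume "x \<notin> {lo..<hi}"
    then have "x + 1 \<le> lo \<or> x \<ge> hi" by auto
    then have "S x = S (x + 1)" using b by auto
    with that show False by (simp add: unlike_pairs_def)
  qed
  have sum_S: "inversion_length S = (\<Sum>c\<in>{lo..<hi}. ?F c S)"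
    by (rule inversion_length_eq_sum) (use assms b in auto)
  have sum_T: "inversion_length (set_pair S x a b) = (\<Sum>c\<in>{lo..<hi}. ?F c (set_pair S x a b))"
    if "x \<in> ?U" for x a b
    by (rule inversion_length_eq_sum)
      (use assms b window[OF that] in \<open>auto simp: set_pair_def config_set_pair[unfolded set_pair_def]\<close>)
  have pair: "inversion_length S + (of_bool (S x) - of_bool (S (x + 1))) * ?A x / 2
      \<le> pair_mean \<beta> p inversion_length S x" if x: "x \<in> ?U" for x
  proof -
    have "inversion_length S + (of_bool (S x) - of_bool (S (x + 1))) * ?A x / 2
      = (\<Sum>c\<in>{lo..<hi}. ?F c S + (if c = x then (of_bool (S x) - of_bool (S (x + 1))) * ?A x / 2 else 0))"
      using window[OF x] by (simp add: sum_S sum.distrib)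
    also have "\<dots> \<le> (\<Sum>c\<in>{lo..<hi}. pair_mean \<beta> p (?F c) S x)"
      by (intro sum_mono pair_mean_zeros_times_ones assms x)
    also have "\<dots> = pair_mean \<beta> p inversion_length S x"
      unfolding pair_mean_sum[symmetric] by (simp add: pair_mean_def sum_S sum_T[OF x])
    finally show ?thesis .
  qed
  have A_Suc: "?A (x + 1) - ?A x = 1 - 2 * of_bool (S (x + 1))" for x
    using assms by (simp add: zeros_upto_Suc ones_after_Suc)
  have "(\<Sum>x\<in>?U. (of_bool (S x) - of_bool (S (x + 1))) * ?A x)
      = ?A lo + (\<Sum>x\<in>{lo..<hi}. of_bool (S (x + 1)) * (?A (x + 1) - ?A x))"
    by (rule sum_unlike_pairs_by_parts[OF b])
  also have "(\<Sum>x\<in>{lo..<hi}. of_bool (S (x + 1)) * (?A (x + 1) - ?A x))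
      = - (\<Sum>x\<in>{lo..<hi}. ones_after x S - ones_after (x + 1) S)"
    unfolding A_Suc sum_negf[symmetric]
    by (intro sum.cong) (use assms in \<open>auto simp: ones_after_Suc\<close>)
  also have "\<dots> = - ones_after lo S + ones_after hi S"
    using summation_by_parts[of lo hi "\<lambda>x. ones_after x S" "\<lambda>x. 1"] b by simp
  also have "ones_after hi S = 0"
    using ones_after_ne_0_iff[OF assms(1), of hi] b by auto
  also have "zeros_upto lo S = 0"
    using zeros_upto_ne_0_iff[OF assms(1), of lo] b by auto
  finally have zero: "(\<Sum>x\<in>?U. (of_bool (S x) - of_bool (S (x + 1))) * ?A x) = 0"
    by simp
  have "inversion_length S * card ?U
      = (\<Sum>x\<in>?U. inversion_length S + (of_bool (S x) - of_bool (S (x + 1))) * ?A x / 2)"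
    unfolding sum.distrib sum_divide_distrib[symmetric] zero by simp
  also have "\<dots> \<le> (\<Sum>x\<in>?U. pair_mean \<beta> p inversion_length S x)"
    by (intro sum_mono pair)
  finally show "inversion_length S * card ?U \<le> (\<Sum>x\<in>?U. pair_mean \<beta> p inversion_length S x)" .
qed (use assms in auto)

section \<open>Wide configurations\<close>

definition wide :: "int \<Rightarrow> (int \<Rightarrow> bool) \<Rightarrow> bool" where
  "wide D S \<longleftrightarrow> (\<exists>x y. \<not> S x \<and> S y \<and> D \<le> y - x)"

lemma wide_set_pair:
  assumes "wide (D + 2) (set_pair S x a b)" "x \<in> unlike_pairs S"
  shows "wide D S"
proof -
  obtain u v where uv: "\<not> set_pair S x a b u" "set_pair S x a b v" "D + 2 \<le> v - u"
    using assms(1) by (auto simp: wide_def)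
  have pair: "S x \<noteq> S (x + 1)" using assms(2) by (simp add: unlike_pairs_def)
  have near: "\<exists>z'. S z' = l \<and> \<bar>z' - z\<bar> \<le> 1" if "set_pair S x a b z = l" for z l
  proof (cases "z = x \<or> z = x + 1")
    case True
    show ?thesis
    proof (cases "S x = l")
      case True
      then show ?thesis using \<open>z = x \<or> z = x + 1\<close> by (intro exI[of _ x]) auto
    next
      case False
      then have "S (x + 1) = l" using pair by auto
      then show ?thesis using \<open>z = x \<or> z = x + 1\<close> by (intro exI[of _ "x + 1"]) auto
    qed
  next
    case False
    then show ?thesis using that by (intro exI[of _ z]) (simp add: set_pair_def)
  qed
  obtain u' where "S u' = False" "\<bar>u' - u\<bar> \<le> 1" using near[of u False] uv(1) by auto
  moreover obtain v' where "S v' = True" "\<bar>v' - v\<bar> \<le> 1" using near[of v True] uv(2) by auto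
  ultimately show ?thesis using uv(3) unfolding wide_def by (intro exI[of _ u'] exI[of _ v']) auto
qed

lemma wide_mono: "wide D S \<Longrightarrow> D' \<le> D \<Longrightarrow> wide D' S"
  unfolding wide_def using order_trans by blast

lemma wide_step:
  assumes "config S" "T \<in> set_pmf (step \<beta> p S)" "wide (D + 2) T"
  shows "wide D S"
  using set_step[OF assms(1,2)]
proof (elim disjE bexE exE)
  assume "T = S"
  then show ?thesis using wide_mono[OF assms(3), of D] by simp
next
  fix x a b assume "x \<in> unlike_pairs S" "T = set_pair S x a b"
  then show ?thesis using wide_set_pair assms(3) by blast
qed

text \<open>
  All inversions of a configuration that is not wide are shorter than \<open>D\<close>: there are at most \<open>D\<close>
  relevant sites \<open>c\<close>, each with at most \<open>D\<close> zeros on the left and \<open>D\<close> ones on the right.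
\<close>

lemma inversion_length_le:
  assumes "config S" "\<not> wide D S"
  shows "inversion_length S \<le> real (nat D) ^ 3"
proof -
  let ?C = "{c. zeros_upto c S * ones_after c S \<noteq> 0}"
  have gap: "y - x < D" if "\<not> S x" "S y" for x y
    using assms(2) that unfolding wide_def by fastforce
  have C: "(\<exists>x\<le>c. \<not> S x) \<and> (\<exists>y>c. S y)" if "c \<in> ?C" for c
    using that zeros_upto_ne_0_iff[OF assms(1)] ones_after_ne_0_iff[OF assms(1)] by auto
  have term_le: "zeros_upto c S * ones_after c S \<le> real (nat D) ^ 2" if c: "c \<in> ?C" for c
  proof -
    obtain x y where xy: "x \<le> c" "\<not> S x" "c < y" "S y" using C[OF c] by blast
    have "{z. z \<le> c \<and> \<not> S z} \<subseteq> {c - D<..c}"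
      using gap[OF _ xy(4)] xy(3) by fastforce
    then have "card {z. z \<le> c \<and> \<not> S z} \<le> nat D"
      using card_mono[of "{c - D<..c}"] by fastforce
    moreover have "{z. c < z \<and> S z} \<subseteq> {c<..c + D}"
      using gap[OF xy(2)] xy(1) by fastforce
    then have "card {z. c < z \<and> S z} \<le> nat D"
      using card_mono[of "{c<..c + D}"] by fastforce
    ultimately show ?thesis
      unfolding power2_eq_square zeros_upto_card ones_after_card
      by (intro mult_mono) auto
  qed
  have "card ?C \<le> nat D"
  proof (cases "?C = {}")
    case False
    obtain lo hi where b: "lo < hi" "\<forall>x\<le>lo. S x" "\<forall>x\<ge>hi. \<not> S x"
      using config_bounds[OF assms(1)] by blast
    have "?C \<subseteq> {lo..hi}"
    proof
      fix c assume "c \<in> ?C"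
      then obtain x y where "x \<le> c" "\<not> S x" "c < y" "S y" using C by blast
      then have "\<not> x \<le> lo" "\<not> hi \<le> y" using b by auto
      then show "c \<in> {lo..hi}" using \<open>x \<le> c\<close> \<open>c < y\<close> by simp
    qed
    then have fin: "finite ?C" by (rule finite_subset) simp
    obtain x where x: "x \<le> Min ?C" "\<not> S x" using C[OF Min_in[OF fin False]] by blast
    have "?C \<subseteq> {x..<x + D}"
    proof
      fix c assume c: "c \<in> ?C"
      then obtain y where "c < y" "S y" using C by blast
      then show "c \<in> {x..<x + D}" using gap[OF x(2), of y] Min_le[OF fin c] x(1) by simp
    qed
    then show ?thesis using card_mono[of "{x..<x + D}" ?C] by simp
  next
    case True
    then show ?thesis by (simp only: card.empty)
  qed
  have "inversion_length S \<le> real (card ?C) * real (nat D) ^ 2"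
    unfolding inversion_length_def by (rule sum_bounded_above[OF term_le])
  also have "\<dots> \<le> real (nat D) * real (nat D) ^ 2"
    using \<open>card ?C \<le> nat D\<close> by (intro mult_right_mono) auto
  also have "\<dots> = real (nat D) ^ 3" by (simp add: power3_eq_cube power2_eq_square)
  finally show ?thesis .
qed

lemma inversion_length_ground:
  assumes "config S" "abs_conf S = ground"
  shows "inversion_length S = 0"
proof -
  have "{c. zeros_upto c S * ones_after c S \<noteq> 0} = {}"
    using zeros_upto_ne_0_iff[OF assms(1)] ones_after_ne_0_iff[OF assms(1)]
      abs_conf_eq_ground_iff[OF assms(1)] assms(2) by fastforce
  then show ?thesis unfolding inversion_length_def by (simp only: sum.empty)
qed

lemma inversion_length_pos:
  assumes "config S" "abs_conf S \<noteq> ground"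
  shows "inversion_length S > 0"
proof -
  obtain lo hi where b: "lo < hi" "\<forall>x\<le>lo. S x" "\<forall>x\<ge>hi. \<not> S x"
    using config_bounds[OF assms(1)] by blast
  obtain x y where xy: "x < y" "\<not> S x" "S y"
    using assms abs_conf_eq_ground_iff by blast
  then have "\<not> x \<le> lo" "\<not> hi \<le> y" using b by auto
  then have x: "x \<in> {lo..<hi}" using xy(1) by simp
  have "zeros_upto x S \<noteq> 0" "ones_after x S \<noteq> 0"
    using zeros_upto_ne_0_iff[OF assms(1)] ones_after_ne_0_iff[OF assms(1)] xy by auto
  then have "0 < zeros_upto x S * ones_after x S"
    by (simp add: less_le)
  also have "\<dots> \<le> (\<Sum>c\<in>{lo..<hi}. zeros_upto c S * ones_after c S)"
    using x by (intro member_le_sum[of x]) auto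
  also have "\<dots> = inversion_length S"
    by (rule inversion_length_eq_sum[symmetric]) (use assms b in auto)
  finally show ?thesis .
qed

section \<open>A saturating cubic\<close>

text \<open>
  On the nonnegative reals, this is a concave, continuously differentiable function that saturates
  at 1 and whose second derivative \<open>- 3 u\<close> (up to the saturation) vanishes at 0. The last property makes the error of linearisation proportional to the
  function itself, so that it can be absorbed into a multiplicative loss; the sine would serve as well, but a
  cubic has exact finite differences.
\<close>

definition cap :: "real \<Rightarrow> real" where
  "cap u = (if u \<le> 0 then 0 else if u \<le> 1 then (3 * u - u ^ 3) / 2 else 1)"

definition cap_slope :: "real \<Rightarrow> real" where
  "cap_slope u = (if u \<le> 1 then 3 * (1 - u\<^sup>2) / 2 else 0)"

lemma cubic_le_1:
  fixes u :: real
  assumes "0 \<le> u" shows "(3 * u - u ^ 3) / 2 \<le> 1"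
proof -
  have "0 \<le> (1 - u)\<^sup>2 * (u + 2)" using assms by simp
  also have "\<dots> = 2 - (3 * u - u ^ 3)" by algebra
  finally show ?thesis by simp
qed

lemma cube_le_self:
  fixes u :: real
  assumes "0 \<le> u" "u \<le> 1" shows "u ^ 3 \<le> u"
  using power_decreasing[of 1 3 u] assms by simp

lemma cap_le_1: "cap u \<le> 1"
  using cubic_le_1[of u] by (simp add: cap_def)

lemma le_cap: "0 \<le> u \<Longrightarrow> u \<le> 1 \<Longrightarrow> u \<le> cap u"
  using cube_le_self[of u] by (simp add: cap_def)

lemma cap_nonneg: "0 \<le> cap u"
  using le_cap[of u] by (cases "0 \<le> u \<and> u \<le> 1") (auto simp: cap_def)

lemma cap_nonpos [simp]: "u \<le> 0 \<Longrightarrow> cap u = 0"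
  by (simp add: cap_def)

lemma cap_ge_1 [simp]: "1 \<le> u \<Longrightarrow> cap u = 1"
  by (simp add: cap_def)

lemma cap_mono: "u \<le> v \<Longrightarrow> cap u \<le> cap v"
proof -
  assume uv: "u \<le> v"
  show ?thesis
  proof (cases "0 < u \<and> v \<le> 1")
    case True
    have "u * u \<le> 1 * 1" "u * v \<le> 1 * 1" "v * v \<le> 1 * 1"
      using True uv by (intro mult_mono; simp)+
    then have "0 \<le> (v - u) * (3 - (v * v + u * v + u * u))" using uv by simp
    also have "\<dots> = (3 * v - v ^ 3) - (3 * u - u ^ 3)" by algebra
    finally show ?thesis using True uv by (simp add: cap_def)
  next
    case False
    then show ?thesis
      using uv cap_nonneg[of v] cap_le_1[of u] by (cases "u \<le> 0") auto
  qed
qed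

lemma cap_add_le:
  assumes "0 \<le> u" "0 \<le> v" shows "cap (u + v) \<le> cap u + cap v"
proof (cases "u + v \<le> 1")
  case True
  have "0 \<le> 3 * u * v * (u + v)" using assms by simp
  also have "\<dots> = (u + v) ^ 3 - (u ^ 3 + v ^ 3)" by algebra
  finally have "(3 * (u + v) - (u + v) ^ 3) / 2 \<le> (3 * u - u ^ 3) / 2 + (3 * v - v ^ 3) / 2"
    by argo
  moreover have cap: "cap z = (3 * z - z ^ 3) / 2" if "0 \<le> z" "z \<le> 1" for z
    using that by (auto simp: cap_def)
  ultimately show ?thesis using True assms by (simp only: cap)
next
  case False
  have "1 \<le> cap u + cap v"
  proof (cases "u \<le> 1 \<and> v \<le> 1")
    case True
    then show ?thesis using le_cap[of u] le_cap[of v] assms False by simp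
  next
    case False
    then show ?thesis using cap_nonneg[of u] cap_nonneg[of v] by auto
  qed
  then show ?thesis using cap_le_1[of "u + v"] by linarith
qed

lemma le_two_cap: "u \<le> 2 \<Longrightarrow> u \<le> 2 * cap u"
  using le_cap[of u] cap_nonneg[of u] by (cases "u \<le> 0"; cases "u \<le> 1") auto

lemma cap_slope_nonneg: "0 \<le> u \<Longrightarrow> 0 \<le> cap_slope u"
  by (simp add: cap_slope_def power_le_one)

lemma cap_slope_mult_le: "0 \<le> u \<Longrightarrow> cap_slope u * u \<le> cap u"
proof (cases "u \<le> 1")
  case True
  assume "0 \<le> u"
  then show ?thesis using True
    by (auto simp: cap_slope_def cap_def field_simps power2_eq_square power3_eq_cube)
qed (simp add: cap_slope_def)

text \<open>
  For the cubic itself this is an identity; the saturated part lies above the cubic because the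
  cubic is at most 1 on the nonnegative reals.
\<close>

lemma cap_taylor:
  assumes "0 \<le> u" "0 \<le> v"
  shows "cap u + cap_slope u * (v - u) - (v - u)\<^sup>2 * (v + 2 * u) / 2 \<le> cap v"
proof -
  have cubic_le: "(3 * v - v ^ 3) / 2 \<le> cap v" if "0 \<le> v" for v
    using cubic_le_1[OF that] that by (auto simp: cap_def)
  show ?thesis
  proof (cases "u \<le> 1")
    case True
    then have "cap u = (3 * u - u ^ 3) / 2" using assms by (simp add: cap_def)
    then have "cap u + cap_slope u * (v - u) - (v - u)\<^sup>2 * (v + 2 * u) / 2 = (3 * v - v ^ 3) / 2"
      using True by (simp add: cap_slope_def field_simps power2_eq_square power3_eq_cube)
    then show ?thesis using cubic_le[OF assms(2)] by simp
  next
    case False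
    show ?thesis
    proof (cases "v \<le> 1")
      case True
      have "(1 - v)\<^sup>2 * (v + 2) \<le> (u - v)\<^sup>2 * (v + 2 * u)"
        using False True assms by (intro mult_mono power_mono) auto
      moreover have "(1 - v)\<^sup>2 * (v + 2) = 2 - (3 * v - v ^ 3)" by algebra
      ultimately have "1 - (u - v)\<^sup>2 * (v + 2 * u) / 2 \<le> (3 * v - v ^ 3) / 2"
        by (simp add: field_simps)
      then show ?thesis
        using False cubic_le[OF assms(2)] by (simp add: cap_slope_def power2_commute)
    next
      case outer: False
      have "0 \<le> (v - u)\<^sup>2 * (v + 2 * u)" using assms by simp
      then show ?thesis using False outer by (simp add: cap_slope_def)
    qed
  qed
qed

text \<open>
  The case \<open>0 < u < h\<close>, where the kink of \<open>cap\<close> at 0 is close, does not occur on a lattice of mesh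
  \<open>h\<close>.
\<close>

lemma cap_second_difference:
  assumes "0 < h" "h \<le> 1" "u \<le> 0 \<or> h \<le> u"
  shows "- 6 * h\<^sup>2 * cap u \<le> cap (u + h) + cap (u - h) - 2 * cap u"
proof (cases "u \<le> 0")
  case True
  then show ?thesis using assms cap_nonneg[of "u + h"] by simp
next
  case False
  then have u: "h \<le> u" using assms by simp
  show ?thesis
  proof (cases "u \<le> 2")
    case True
    have "cap u + cap_slope u * h - h\<^sup>2 * (3 * u + h) / 2 \<le> cap (u + h)"
      using cap_taylor[of u "u + h"] u assms by (simp add: algebra_simps)
    moreover have "cap u - cap_slope u * h - h\<^sup>2 * (3 * u - h) / 2 \<le> cap (u - h)"
      using cap_taylor[of u "u - h"] u assms by (simp add: algebra_simps)
    moreover have "h\<^sup>2 * (3 * u) \<le> h\<^sup>2 * (3 * (2 * cap u))"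
      using le_two_cap[OF True] by (intro mult_left_mono) auto
    ultimately show ?thesis by (simp add: field_simps)
  next
    case False
    then show ?thesis using assms by simp
  qed
qed

section \<open>Ones far to the right of a site\<close>

text \<open>
  The weights start at \<open>c\<close> and saturate at distance \<open>L\<close>; their discrete Laplacian is at least
  \<open>- O(1 / L\<^sup>2)\<close> times the weight.
\<close>

definition ramp :: "int \<Rightarrow> nat \<Rightarrow> int \<Rightarrow> real" where
  "ramp c L y = cap (of_int (y - c) / real L)"

text \<open>
  The same cutoff is applied once more to the total weight: the score is positive as soon as there
  is a 1 to the right of \<open>c\<close>, and of order 1 when there are of order \<open>L\<close> of them far from \<open>c\<close>.
\<close>

definition right_score :: "int \<Rightarrow> nat \<Rightarrow> (int \<Rightarrow> bool) \<Rightarrow> real" where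
  "right_score c L S = cap (ones_weight (ramp c L) S / real L)"

lemma ramp_nonneg: "0 \<le> ramp c L y"
  by (simp add: ramp_def cap_nonneg)

lemma ramp_le_1: "ramp c L y \<le> 1"
  by (simp add: ramp_def cap_le_1)

lemma ramp_eq_0: "y \<le> c \<Longrightarrow> ramp c L y = 0"
  by (simp add: ramp_def divide_nonpos_nonneg)

lemma ramp_mono: "x \<le> y \<Longrightarrow> ramp c L x \<le> ramp c L y"
  by (auto simp: ramp_def intro!: cap_mono divide_right_mono)

lemma ramp_second_difference:
  assumes "L > 0"
  shows "- 6 / (real L)\<^sup>2 * ramp c L y \<le> ramp c L (y + 1) + ramp c L (y - 1) - 2 * ramp c L y"
proof -
  let ?u = "of_int (y - c) / real L" and ?h = "1 / real L"
  have "?u \<le> 0 \<or> ?h \<le> ?u"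
    by (cases "y \<le> c") (auto simp: divide_nonpos_nonneg divide_right_mono)
  moreover have "of_int (y + 1 - c) / real L = ?u + ?h" "of_int (y - 1 - c) / real L = ?u - ?h"
    by (simp_all add: add_divide_distrib diff_divide_distrib)
  ultimately show ?thesis
    using cap_second_difference[of ?h ?u] assms by (simp add: ramp_def power_divide)
qed

lemma ramp_Suc_le:
  assumes "c \<le> x" shows "ramp c L (x + 1) \<le> ramp c L x + ramp c L (c + 1)"
proof -
  have "of_int (x + 1 - c) / real L = of_int (x - c) / real L + 1 / real L"
    by (simp add: add_divide_distrib diff_divide_distrib)
  then show ?thesis
    using cap_add_le[of "of_int (x - c) / real L" "1 / real L"] assms by (simp add: ramp_def)
qed

text \<open>
  A move creates a 1 only next to a site that held a 1. Neighbouring weights differ by at most the weight of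
  \<open>c + 1\<close>, which in turn is at most the weight of any 1 that counts at all. Hence the total weight
  at most triples.
\<close>

lemma ones_weight_ramp_jump:
  assumes "config S" "x \<in> unlike_pairs S" "ones_weight (ramp c L) S > 0"
  shows "\<bar>ones_weight (ramp c L) (set_pair S x a b) - ones_weight (ramp c L) S\<bar> \<le> 1"
    and "ones_weight (ramp c L) (set_pair S x a b) \<le> 3 * ones_weight (ramp c L) S"
proof -
  let ?w = "ramp c L" and ?W = "ones_weight (ramp c L)"
  have upd: "?W (set_pair S x a b) = ?W S
      + (of_bool a - of_bool (S x)) * ?w x + (of_bool b - of_bool (S (x + 1))) * ?w (x + 1)"
    by (rule ones_weight_set_pair[OF assms(1) ramp_eq_0])
  have le: "?w y \<le> ?W S" if "S y" for y
    by (rule weight_le_ones_weight[OF assms(1) ramp_eq_0 ramp_nonneg that])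
  have bounds: "0 \<le> ?w x" "?w x \<le> ?w (x + 1)" "?w (x + 1) \<le> 1"
    by (simp_all add: ramp_nonneg ramp_mono ramp_le_1)
  obtain y where y: "?w y \<noteq> 0" "S y"
    using assms(3) unfolding ones_weight_def by (metis (mono_tags, lifting) less_irrefl mem_Collect_eq sum.neutral)
  then have "c + 1 \<le> y" using ramp_eq_0[of y c L] by linarith
  then have "?w (c + 1) \<le> ?W S" using ramp_mono[of "c + 1" y c L] le[OF y(2)] by linarith
  have next_le: "?w (x + 1) \<le> 2 * ?W S"
  proof (cases "S x")
    case True
    show ?thesis
    proof (cases "c \<le> x")
      case True
      then show ?thesis
        using ramp_Suc_le[OF True, of L] le[OF \<open>S x\<close>] \<open>?w (c + 1) \<le> ?W S\<close> by linarith
    next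
      case False
      then show ?thesis using ramp_eq_0[of "x + 1" c L] assms(3) by simp
    qed
  next
    case False
    then have "S (x + 1)" using assms(2) by (simp add: unlike_pairs_def)
    then show ?thesis using le[of "x + 1"] assms(3) by simp
  qed
  show "\<bar>?W (set_pair S x a b) - ?W S\<bar> \<le> 1"
    using assms(2) bounds unfolding upd
    by (cases a; cases b; cases "S x") (auto simp: unlike_pairs_def)
  show "?W (set_pair S x a b) \<le> 3 * ?W S"
    using assms(2) bounds next_le unfolding upd
    by (cases a; cases b; cases "S x") (auto simp: unlike_pairs_def)
qed

text \<open>
  Jumps of \<open>u\<close> have size at most \<open>1 / L\<close>, and after a jump the value is still comparable to \<open>u\<close>, so
  the error term of \<open>cap_taylor\<close> is of order \<open>u / L\<^sup>2\<close>. For \<open>u > 2\<close> the score is saturated before and after.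
\<close>

lemma right_score_taylor:
  fixes a b :: bool
  assumes "config S" "x \<in> unlike_pairs S" "ones_weight (ramp c L) S > 0" "L > 0"
  defines "u \<equiv> ones_weight (ramp c L) S / real L"
  defines "v \<equiv> ones_weight (ramp c L) (set_pair S x a b) / real L"
  shows "cap u + cap_slope u * (v - u) - 5 / (real L)\<^sup>2 * cap u \<le> cap v"
proof (cases "u \<le> 2")
  case True
  have u: "0 < u" using assms by simp
  have v: "0 \<le> v" unfolding v_def by (simp add: ones_weight_nonneg ramp_nonneg)
  have "v \<le> 3 * u" using ones_weight_ramp_jump(2)[OF assms(1-3), of a b] assms(4)
    by (simp add: u_def v_def divide_right_mono)
  have "\<bar>v - u\<bar> \<le> 1 / real L"
    using ones_weight_ramp_jump(1)[OF assms(1-3), of a b] assms(4)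
    by (simp add: u_def v_def diff_divide_distrib[symmetric] divide_right_mono)
  then have "(v - u)\<^sup>2 \<le> (1 / real L)\<^sup>2"
    using power_mono[of "\<bar>v - u\<bar>" "1 / real L" 2] by simp
  then have "(v - u)\<^sup>2 * (v + 2 * u) \<le> (1 / real L)\<^sup>2 * (5 * u)"
    using \<open>v \<le> 3 * u\<close> u v by (intro mult_mono) auto
  also have "\<dots> \<le> (1 / real L)\<^sup>2 * (5 * (2 * cap u))"
    using le_two_cap[OF True] by (intro mult_left_mono) auto
  finally have "(v - u)\<^sup>2 * (v + 2 * u) / 2 \<le> 5 / (real L)\<^sup>2 * cap u"
    by (simp add: power_divide)
  then show ?thesis using cap_taylor[of u v] u v by linarith
next
  case False
  have "\<bar>v - u\<bar> \<le> 1 / real L"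
    using ones_weight_ramp_jump(1)[OF assms(1-3), of a b] assms(4)
    by (simp add: u_def v_def diff_divide_distrib[symmetric] divide_right_mono)
  also have "\<dots> \<le> 1" using assms(4) by simp
  finally have "1 \<le> v" using False by linarith
  then show ?thesis using False by (simp add: cap_slope_def)
qed

text \<open>
  In units of \<open>1 / L\<^sup>2\<close>, a loss of 5 comes from the concavity of the outer cutoff, and a loss of 3 from
  the concavity of the weights, through their discrete Laplacian.
\<close>

lemma right_score_drift:
  assumes "config S" "L > 0" "0 \<le> \<beta>" "\<beta> \<le> 1" "0 \<le> p" "p \<le> 1 / 2"
  shows "(1 - 8 / (real L)\<^sup>2) * right_score c L S * card (unlike_pairs S)
    \<le> (\<Sum>x\<in>unlike_pairs S. pair_mean \<beta> p (right_score c L) S x)"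
proof (cases "ones_weight (ramp c L) S > 0")
  case False
  then have "ones_weight (ramp c L) S = 0"
    using ones_weight_nonneg[of "ramp c L" S] ramp_nonneg by fastforce
  then have z: "right_score c L S = 0" by (simp add: right_score_def)
  have "0 \<le> pair_mean \<beta> p (right_score c L) S x" for x
    using pair_mean_mono[of \<beta> p "\<lambda>_. 0" S x "right_score c L"] assms
    by (simp add: right_score_def cap_nonneg pair_mean_def)
  then show ?thesis by (simp add: z sum_nonneg)
next
  case True
  let ?U = "unlike_pairs S" and ?w = "ramp c L" and ?W = "ones_weight (ramp c L)"
  define u where "u = ?W S / real L"
  define m where "m = cap_slope u / real L"
  define d where "d = cap u - cap_slope u * u - 5 / (real L)\<^sup>2 * cap u"
  have u: "0 < u" using True assms by (simp add: u_def)
  have m: "0 \<le> m" using cap_slope_nonneg[of u] u by (simp add: m_def)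
  have card: "card ?U \<ge> 1"
    using assms(1) by (simp add: Suc_le_eq card_gt_0_iff finite_unlike_pairs unlike_pairs_nonempty)
  have score: "right_score c L S = cap u" by (simp add: right_score_def u_def)
  have mW: "m * ?W S = cap_slope u * u" by (simp add: m_def u_def)
  have pair: "d + m * pair_mean \<beta> p ?W S x \<le> pair_mean \<beta> p (right_score c L) S x"
    if x: "x \<in> ?U" for x
    unfolding pair_mean_affine[symmetric]
  proof (rule pair_mean_mono)
    show "d + m * ?W (set_pair S x a b) \<le> right_score c L (set_pair S x a b)" for a b
      using right_score_taylor[OF assms(1) x True assms(2), of a b]
      by (simp add: right_score_def d_def m_def u_def algebra_simps)
    show "d + m * ?W S \<le> right_score c L S"
      using cap_nonneg[of u] by (simp add: score mW d_def)
  qed (use assms in auto)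
  obtain lo hi where b: "lo < hi" "\<forall>x\<le>lo. S x" "\<forall>x\<ge>hi. \<not> S x"
    using config_bounds[OF assms(1)] by blast
  \<comment> \<open>Left of \<open>c\<close> the weights vanish, and with them the boundary term of the summation by parts.\<close>
  define lo' where "lo' = min lo (c - 1)"
  have b': "lo' < hi" "\<forall>x\<le>lo'. S x" "\<forall>x\<ge>hi. \<not> S x" using b by (auto simp: lo'_def)
  let ?g = "\<lambda>x. ?w (x + 1) - ?w x"
  have "- 6 / (real L)\<^sup>2 * ?W S
      \<le> (\<Sum>x\<in>?U. (of_bool (S x) - of_bool (S (x + 1))) * ?g x)"
  proof -
    have "?W S = (\<Sum>y\<in>{lo' + 1..<hi + 1}. of_bool (S y) * ?w y)"
    proof (rule ones_weight_eq_sum)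
      show "{y. ?w y \<noteq> 0 \<and> S y} \<subseteq> {lo' + 1..<hi + 1}"
      proof
        fix y assume y: "y \<in> {y. ?w y \<noteq> 0 \<and> S y}"
        then have "\<not> y \<le> c" "\<not> hi \<le> y" using ramp_eq_0[of y c L] b by auto
        then show "y \<in> {lo' + 1..<hi + 1}" by (simp add: lo'_def)
      qed
    qed simp
    also have "\<dots> = (\<Sum>x\<in>{lo'..<hi}. of_bool (S (x + 1)) * ?w (x + 1))"
      by (rule sum.reindex_bij_witness[of _ "\<lambda>x. x + 1" "\<lambda>x. x - 1"]) auto
    finally have W: "?W S = (\<Sum>x\<in>{lo'..<hi}. of_bool (S (x + 1)) * ?w (x + 1))" .
    have "- 6 / (real L)\<^sup>2 * ?W S
      = (\<Sum>x\<in>{lo'..<hi}. of_bool (S (x + 1)) * (- 6 / (real L)\<^sup>2 * ?w (x + 1)))"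
      unfolding W sum_distrib_left by (intro sum.cong) auto
    also have "\<dots> \<le> (\<Sum>x\<in>{lo'..<hi}. of_bool (S (x + 1)) * (?g (x + 1) - ?g x))"
    proof (intro sum_mono mult_left_mono)
      fix x
      show "- 6 / (real L)\<^sup>2 * ?w (x + 1) \<le> ?g (x + 1) - ?g x"
        using ramp_second_difference[OF assms(2), of c "x + 1"] by simp
    qed simp
    also have "\<dots> = ?g lo' + \<dots>"
      using ramp_eq_0[of lo' c L] ramp_eq_0[of "lo' + 1" c L] by (simp add: lo'_def)
    also have "\<dots> = (\<Sum>x\<in>?U. (of_bool (S x) - of_bool (S (x + 1))) * ?g x)"
      by (rule sum_unlike_pairs_by_parts[OF b', symmetric])
    finally show ?thesis .
  qed
  then have "card ?U * ?W S - 3 / (real L)\<^sup>2 * ?W S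
      \<le> (\<Sum>x\<in>?U. ?W S + (of_bool (S x) - of_bool (S (x + 1))) * ?g x / 2)"
    unfolding sum.distrib sum_divide_distrib[symmetric] by simp
  also have "\<dots> \<le> (\<Sum>x\<in>?U. pair_mean \<beta> p ?W S x)"
    by (intro sum_mono ones_weight_drift[OF assms(1) ramp_eq_0]) (use assms in \<open>auto simp: ramp_mono\<close>)
  finally have drift: "card ?U * ?W S - 3 / (real L)\<^sup>2 * ?W S \<le> (\<Sum>x\<in>?U. pair_mean \<beta> p ?W S x)" .
  have "cap_slope u * u * (3 / (real L)\<^sup>2) \<le> cap u * (3 / (real L)\<^sup>2)"
    using cap_slope_mult_le[of u] u by (intro mult_right_mono) auto
  also have "cap u * (3 / (real L)\<^sup>2) \<le> card ?U * (cap u * (3 / (real L)\<^sup>2))"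
    using mult_right_mono[of 1 "real (card ?U)" "cap u * (3 / (real L)\<^sup>2)"] card cap_nonneg[of u]
    by simp
  finally have "(1 - 8 / (real L)\<^sup>2) * cap u * card ?U
      \<le> card ?U * d + m * (card ?U * ?W S - 3 / (real L)\<^sup>2 * ?W S)"
    unfolding right_diff_distrib mult.left_commute[of m] mW d_def by (simp add: algebra_simps)
  also have "\<dots> \<le> card ?U * d + m * (\<Sum>x\<in>?U. pair_mean \<beta> p ?W S x)"
    using drift m by (intro add_left_mono mult_left_mono)
  also have "\<dots> = (\<Sum>x\<in>?U. d + m * pair_mean \<beta> p ?W S x)"
    by (simp add: sum.distrib sum_distrib_left)
  also have "\<dots> \<le> (\<Sum>x\<in>?U. pair_mean \<beta> p (right_score c L) S x)"
    by (intro sum_mono pair)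
  finally show ?thesis by (simp add: score)
qed

lemma right_score_ge:
  assumes "config S" "L > 0" "finite A" "\<And>z. z \<in> A \<Longrightarrow> S z \<and> c + int L \<le> z"
    and "0 \<le> r" "r \<le> 1" "r * real L \<le> real (card A)"
  shows "r \<le> right_score c L S"
proof -
  have "ramp c L z = 1" if "z \<in> A" for z
  proof -
    have "real L \<le> of_int (z - c)" using assms(4)[OF that] by linarith
    then show ?thesis using assms(2) by (simp add: ramp_def)
  qed
  then have "real (card A) = (\<Sum>z\<in>A. ramp c L z)" by simp
  also have "\<dots> \<le> ones_weight (ramp c L) S"
    by (rule sum_le_ones_weight[OF assms(1) ramp_eq_0 ramp_nonneg _ assms(3)]) (use assms(4) in auto)
  finally have "r \<le> ones_weight (ramp c L) S / real L"
    using assms(2,7) by (simp add: field_simps)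
  then show ?thesis
    using le_cap[OF assms(5,6)] cap_mono unfolding right_score_def by fastforce
qed

lemma right_score_ne_0:
  assumes "right_score c L S \<noteq> 0" shows "\<exists>y>c. S y"
proof (rule ccontr)
  assume "\<not> (\<exists>y>c. S y)"
  then have "{y. ramp c L y \<noteq> 0 \<and> S y} = {}"
    using ramp_eq_0[of _ c L] by (metis (mono_tags, lifting) Collect_empty_eq not_le)
  then have "ones_weight (ramp c L) S = 0" unfolding ones_weight_def by (simp only: sum.empty)
  with assms show False by (simp add: right_score_def)
qed

lemma right_score_nonneg: "0 \<le> right_score c L S"
  by (simp add: right_score_def cap_nonneg)

lemma right_score_le_1: "right_score c L S \<le> 1"
  by (simp add: right_score_def cap_le_1)

lemma right_score_set_pair_left:
  assumes "config S" "x + 1 \<le> c"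
  shows "right_score c L (set_pair S x a b) = right_score c L S"
proof -
  have "ones_weight (ramp c L) (set_pair S x a b) = ones_weight (ramp c L) S
      + (of_bool a - of_bool (S x)) * ramp c L x
      + (of_bool b - of_bool (S (x + 1))) * ramp c L (x + 1)"
    by (rule ones_weight_set_pair[OF assms(1) ramp_eq_0])
  then have "ones_weight (ramp c L) (set_pair S x a b) = ones_weight (ramp c L) S"
    using assms by (simp add: ramp_eq_0)
  then show ?thesis by (simp add: right_score_def)
qed

section \<open>Wide configurations survive\<close>

definition left_score :: "int \<Rightarrow> nat \<Rightarrow> (int \<Rightarrow> bool) \<Rightarrow> real" where
  "left_score c L S = right_score (- c) L (reflect S)"

lemma left_score_set_pair_right:
  assumes "config S" "c \<le> x"
  shows "left_score c L (set_pair S x a b) = left_score c L S"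
  unfolding left_score_def reflect_set_pair
  by (rule right_score_set_pair_left) (use assms in \<open>auto simp: config_reflect\<close>)

lemma left_score_drift:
  assumes "config S" "L > 0" "0 \<le> \<beta>" "\<beta> \<le> 1" "0 \<le> p" "p \<le> 1 / 2"
  shows "(1 - 8 / (real L)\<^sup>2) * left_score c L S * card (unlike_pairs S)
    \<le> (\<Sum>x\<in>unlike_pairs S. pair_mean \<beta> p (left_score c L) S x)"
proof -
  have "(1 - 8 / (real L)\<^sup>2) * right_score (- c) L (reflect S) * card (unlike_pairs (reflect S))
    \<le> (\<Sum>x\<in>unlike_pairs (reflect S). pair_mean \<beta> p (right_score (- c) L) (reflect S) x)"
    by (rule right_score_drift) (use assms config_reflect in auto)
  then show ?thesis
    unfolding sum_pair_mean_reflect[symmetric] card_unlike_pairs_reflect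
    unfolding left_score_def .
qed

text \<open>
  A move at a pair to the left of \<open>c\<close> does not touch the right score, and vice versa, so the product rule for the
  drift has no correlation term and the relative losses add up.
\<close>

lemma score_drift:
  assumes "config S" "L > 0" "0 \<le> \<beta>" "\<beta> \<le> 1" "0 \<le> p" "p \<le> 1 / 2"
  shows "(1 - 16 / (real L)\<^sup>2) * (left_score c L S * right_score c L S)
    \<le> measure_pmf.expectation (step \<beta> p S) (\<lambda>T. left_score c L T * right_score c L T)"
proof (rule expectation_step_ge)
  let ?U = "unlike_pairs S" and ?l = "left_score c L" and ?r = "right_score c L"
  have pair: "pair_mean \<beta> p (\<lambda>T. ?l T * ?r T) S x
      = ?r S * pair_mean \<beta> p ?l S x + ?l S * pair_mean \<beta> p ?r S x - ?l S * ?r S" for x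
  proof (cases "c \<le> x")
    case True
    then have "?l (set_pair S x a b) = ?l S" for a b
      using left_score_set_pair_right assms by blast
    then show ?thesis by (simp add: pair_mean_def algebra_simps add_divide_distrib)
  next
    case False
    then have "?r (set_pair S x a b) = ?r S" for a b
      using right_score_set_pair_left[OF assms(1)] by simp
    then show ?thesis by (simp add: pair_mean_def algebra_simps add_divide_distrib)
  qed
  have "(1 - 16 / (real L)\<^sup>2) * (?l S * ?r S) * card ?U
      = ?r S * ((1 - 8 / (real L)\<^sup>2) * ?l S * card ?U)
        + ?l S * ((1 - 8 / (real L)\<^sup>2) * ?r S * card ?U) - card ?U * (?l S * ?r S)"
    by (simp add: algebra_simps)
  also have "\<dots> \<le> ?r S * (\<Sum>x\<in>?U. pair_mean \<beta> p ?l S x)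
        + ?l S * (\<Sum>x\<in>?U. pair_mean \<beta> p ?r S x) - card ?U * (?l S * ?r S)"
    by (intro diff_right_mono add_mono mult_left_mono left_score_drift right_score_drift assms)
      (simp_all add: left_score_def right_score_nonneg)
  also have "\<dots> = (\<Sum>x\<in>?U. pair_mean \<beta> p (\<lambda>T. ?l T * ?r T) S x)"
    unfolding pair by (simp add: sum.distrib sum_subtractf sum_distrib_left)
  finally show "(1 - 16 / (real L)\<^sup>2) * (?l S * ?r S) * card ?U
      \<le> (\<Sum>x\<in>?U. pair_mean \<beta> p (\<lambda>T. ?l T * ?r T) S x)" .
qed (use assms in auto)

text \<open>
  Among \<open>L\<close> sites in the middle, one of the labels occurs at least \<open>L / 2\<close> times. If these are ones, \<open>c\<close>
  is put to their left, between them and the given 0; otherwise to their right, before the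
  given 1.
\<close>

lemma wide_score_ge:
  assumes "config S" "L > 0" "wide (5 * int L) S"
  shows "\<exists>c. 1 / (2 * real L) \<le> left_score c L S * right_score c L S"
proof -
  obtain x y where xy: "\<not> S x" "S y" "5 * int L \<le> y - x" using assms(3) by (auto simp: wide_def)
  let ?M = "{x + 2 * int L<..x + 3 * int L}"
  let ?one = "{z\<in>?M. S z}" and ?zero = "{z\<in>?M. \<not> S z}"
  have fin: "finite ?one" "finite ?zero" by (auto intro: finite_subset[of _ ?M])
  have "card ?one + card ?zero = card (?one \<union> ?zero)"
    by (rule card_Un_disjoint[symmetric]) (use fin in auto)
  also have "?one \<union> ?zero = ?M" by auto
  finally have total: "card ?one + card ?zero = L" by simp
  have L: "0 \<le> 1 / real L" "1 / real L \<le> 1" using assms(2) by simp_all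
  note ge = right_score_ge[OF assms(1,2)]
  note ge' = right_score_ge[OF config_reflect[OF assms(1)] assms(2)]
  consider "L \<le> 2 * card ?one" | "L \<le> 2 * card ?zero" using total by linarith
  then show ?thesis
  proof cases
    case 1
    have "1 / 2 \<le> right_score (x + int L) L S"
      by (rule ge[of ?one]) (use 1 fin in auto)
    moreover have "1 / real L \<le> left_score (x + int L) L S"
      unfolding left_score_def
      by (rule ge'[of "{- x}"]) (use xy L assms(2) in \<open>auto simp: reflect_def\<close>)
    ultimately have "1 / real L * (1 / 2) \<le> left_score (x + int L) L S * right_score (x + int L) L S"
      using L by (intro mult_mono) (auto simp: left_score_def right_score_nonneg)
    then show ?thesis by (intro exI[of _ "x + int L"]) (simp add: mult.commute)
  next
    case 2
    have "1 / 2 \<le> left_score (x + 4 * int L) L S"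
      unfolding left_score_def
      by (rule ge'[of "uminus ` ?zero"]) (use 2 fin in \<open>auto simp: reflect_def card_image\<close>)
    moreover have "1 / real L \<le> right_score (x + 4 * int L) L S"
      by (rule ge[of "{y}"]) (use xy L assms(2) in auto)
    ultimately have "1 / 2 * (1 / real L) \<le> left_score (x + 4 * int L) L S * right_score (x + 4 * int L) L S"
      using L by (intro mult_mono) (auto simp: left_score_def right_score_nonneg)
    then show ?thesis by (intro exI[of _ "x + 4 * int L"]) simp
  qed
qed

text \<open>
  The time horizon is chosen such that, by Bernoulli's inequality, the multiplicative losses use up at most half of the
  initial score.
\<close>

lemma survival_wide:
  assumes "config S" "wide (5 * int L) S" "L > 0" "16 * n \<le> L\<^sup>2 div 2" "16 \<le> L\<^sup>2"
    and "0 \<le> \<beta>" "\<beta> \<le> 1" "0 \<le> p" "p \<le> 1 / 2"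
  shows "1 / (4 * real L) \<le> survival \<beta> p n (abs_conf S)"
proof -
  let ?\<rho> = "1 - 16 / (real L)\<^sup>2"
  obtain c where c: "1 / (2 * real L) \<le> left_score c L S * right_score c L S"
    using wide_score_ge assms by blast
  have "real 16 \<le> real (L\<^sup>2)" using assms(5) by (rule of_nat_mono)
  then have small: "16 / (real L)\<^sup>2 \<le> 1" using assms(3) by simp
  have "32 * n \<le> L\<^sup>2" using assms(4) by simp
  then have "real (32 * n) \<le> real (L\<^sup>2)" by (rule of_nat_mono)
  then have "real n * (16 / (real L)\<^sup>2) \<le> 1 / 2" using assms(3) by (simp add: field_simps)
  moreover have "1 + real n * (- (16 / (real L)\<^sup>2)) \<le> (1 + (- (16 / (real L)\<^sup>2))) ^ n"
    by (rule Bernoulli_inequality) (use small in simp)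
  ultimately have "1 / 2 \<le> ?\<rho> ^ n" by simp
  then have "1 / 2 * (1 / (2 * real L)) \<le> ?\<rho> ^ n * (left_score c L S * right_score c L S)"
    using c small by (intro mult_mono) auto
  also have "\<dots> \<le> survival \<beta> p n (abs_conf S)"
  proof (rule survival_ge)
    fix T :: "int \<Rightarrow> bool" assume T: "config T"
    show "left_score c L T * right_score c L T \<le> 1"
      unfolding left_score_def using right_score_le_1 right_score_nonneg by (intro mult_le_one)
    show "?\<rho> * (left_score c L T * right_score c L T)
        \<le> measure_pmf.expectation (step \<beta> p T) (\<lambda>T. left_score c L T * right_score c L T)"
      by (rule score_drift) (use assms T in auto)
    show "left_score c L T * right_score c L T \<le> 0" if "abs_conf T = ground"
    proof (rule ccontr)
      assume "\<not> ?thesis"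
      then have "right_score (- c) L (reflect T) \<noteq> 0" "right_score c L T \<noteq> 0"
        by (auto simp: left_score_def)
      then obtain x y where "x > - c" "reflect T x" "y > c" "T y"
        using right_score_ne_0 by blast
      then have "- x < y" "\<not> T (- x)" by (auto simp: reflect_def)
      then show False using abs_conf_eq_ground_iff[OF T] that \<open>T y\<close> by blast
    qed
  qed (use assms small in auto)
  finally show ?thesis by simp
qed

section \<open>Tail and moments of the relaxation time\<close>

text \<open>
  Induction on time replaces a stopping time: when the configuration is wide, the bound of \<open>survival_wide\<close>
  takes over, and otherwise the submartingale property carries the bound through one step. A step adds at
  most 2 to the width, whence the constant \<open>5 L + 2\<close>.
\<close>

lemma survival_ge_inversion_length:
  assumes "config S" "L > 0" "16 \<le> L\<^sup>2" "16 * n \<le> L\<^sup>2 div 2"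
    and "0 \<le> \<beta>" "\<beta> \<le> 1" "0 \<le> p" "p \<le> 1 / 2"
    and "inversion_length S \<le> real (5 * L + 2) ^ 3"
  shows "inversion_length S / (4 * real L * real (5 * L + 2) ^ 3) \<le> survival \<beta> p n (abs_conf S)"
  using assms(1,4,9)
proof (induction n arbitrary: S)
  case (0 S)
  let ?B = "real (5 * L + 2) ^ 3"
  have "inversion_length S \<le> 1 * ?B" using 0 by simp
  also have "\<dots> \<le> (4 * real L) * ?B" using assms(2) by (intro mult_right_mono) auto
  finally have "inversion_length S / (4 * real L * ?B) \<le> 1"
    using assms(2) by (simp add: divide_le_eq_1)
  then show ?case using inversion_length_ground[OF 0(1)] by simp
next
  case (Suc n S)
  let ?B = "real (5 * L + 2) ^ 3"
  have pos: "0 < 4 * real L * ?B" using assms(2) by simp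
  consider "abs_conf S = ground" | "wide (5 * int L) S" | "abs_conf S \<noteq> ground" "\<not> wide (5 * int L) S"
    by blast
  then show ?case
  proof cases
    case 1
    then show ?thesis using inversion_length_ground[OF Suc.prems(1)] by simp
  next
    case 2
    have "inversion_length S / (4 * real L * ?B) \<le> ?B / (4 * real L * ?B)"
      using Suc.prems(3) pos by (intro divide_right_mono) auto
    also have "\<dots> = 1 / (4 * real L)" using assms(2) by simp
    also have "\<dots> \<le> survival \<beta> p (Suc n) (abs_conf S)"
      by (rule survival_wide) (use Suc.prems 2 assms in auto)
    finally show ?thesis .
  next
    case 3
    have n: "16 * n \<le> L\<^sup>2 div 2" using Suc.prems(2) by simp
    have T: "inversion_length T / (4 * real L * ?B) \<le> survival \<beta> p n (abs_conf T)"
      if T: "T \<in> set_pmf (step \<beta> p S)" for T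
    proof (rule Suc.IH[OF config_step[OF Suc.prems(1) T] n])
      have "\<not> wide (5 * int L + 2) T" using wide_step[OF Suc.prems(1) T] 3(2) by blast
      then have "inversion_length T \<le> real (nat (5 * int L + 2)) ^ 3"
        by (rule inversion_length_le[OF config_step[OF Suc.prems(1) T]])
      also have "nat (5 * int L + 2) = 5 * L + 2" by simp
      finally show "inversion_length T \<le> ?B" .
    qed
    have "inversion_length S / (4 * real L * ?B)
        \<le> measure_pmf.expectation (step \<beta> p S) inversion_length / (4 * real L * ?B)"
      using inversion_length_submartingale[OF Suc.prems(1) assms(5-8)] pos
      by (intro divide_right_mono) auto
    also have "\<dots> = measure_pmf.expectation (step \<beta> p S) (\<lambda>T. inversion_length T / (4 * real L * ?B))"
      by simp
    also have "\<dots> \<le> measure_pmf.expectation (step \<beta> p S) (\<lambda>T. survival \<beta> p n (abs_conf T))"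
      by (intro expectation_step_mono Suc.prems T)
    also have "\<dots> = survival \<beta> p (Suc n) (abs_conf S)"
      by (rule survival_Suc_rep[symmetric]) (use Suc.prems 3 in auto)
    finally show ?thesis .
  qed
qed

text \<open>
  The horizon \<open>k\<^sup>2\<close> is admissible for \<open>L = 6 k\<close>, since \<open>32 k\<^sup>2 \<le> L\<^sup>2\<close>; for large \<open>k\<close> the
  initial inversion length is below the cubic bound.
\<close>

lemma survival_tail:
  assumes "C \<noteq> ground" "0 \<le> \<beta>" "\<beta> \<le> 1" "0 \<le> p" "p \<le> 1 / 2"
  obtains \<delta> K where "\<delta> > 0" "\<And>k. k \<ge> K \<Longrightarrow> k > 0 \<Longrightarrow> \<delta> / real k ^ 4 \<le> survival \<beta> p (k\<^sup>2) C"
proof -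
  obtain S where S: "config S" "abs_conf S = C" by (rule conf_obtain_rep)
  let ?J = "inversion_length S"
  have J: "?J > 0" using inversion_length_pos S assms(1) by blast
  show ?thesis
  proof (rule that)
    show "0 < ?J / (24 * 32 ^ 3)" using J by simp
    fix k :: nat assume k: "k \<ge> nat \<lceil>?J\<rceil>" "k > 0"
    let ?L = "6 * k"
    have "1 \<le> k\<^sup>2" using k(2) by simp
    moreover have "?L\<^sup>2 = 36 * k\<^sup>2" by (simp add: power_mult_distrib)
    ultimately have L: "16 \<le> ?L\<^sup>2" "16 * k\<^sup>2 \<le> ?L\<^sup>2 div 2" by linarith+
    have "?J \<le> real k" using k(1) by linarith
    also have "real k \<le> real (5 * ?L + 2)" by simp
    also have "\<dots> \<le> real (5 * ?L + 2) ^ 3" by (rule self_le_power) auto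
    finally have JB: "?J \<le> real (5 * ?L + 2) ^ 3" .
    have "?J / (24 * 32 ^ 3) / real k ^ 4 = ?J / (4 * real ?L * (32 * real k) ^ 3)"
      by (simp add: power_mult_distrib eval_nat_numeral)
    also have "\<dots> \<le> ?J / (4 * real ?L * real (5 * ?L + 2) ^ 3)"
      using J k(2) by (intro divide_left_mono mult_left_mono power_mono mult_pos_pos) auto
    also have "\<dots> \<le> survival \<beta> p (k\<^sup>2) C"
      unfolding S(2)[symmetric]
      by (rule survival_ge_inversion_length[OF S(1) _ L assms(2-5) JB]) (use k(2) in simp)
    finally show "?J / (24 * 32 ^ 3) / real k ^ 4 \<le> survival \<beta> p (k\<^sup>2) C" .
  qed
qed

lemma relaxation_time_powr_ge:
  assumes "\<And>i. 0 < i \<Longrightarrow> i \<le> n \<Longrightarrow> \<xi> i \<omega> \<noteq> ground" "0 \<le> a"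
  shows "ennreal (real n powr a) \<le> enat_powr (relaxation_time \<xi> \<omega>) a"
proof -
  have "enat n \<le> relaxation_time \<xi> \<omega>"
    unfolding relaxation_time_def
  proof (rule INF_greatest)
    fix t assume "t \<in> {t. 1 \<le> t \<and> \<xi> t \<omega> = ground}"
    then show "enat n \<le> enat t" using assms(1)[of t] by (cases "t \<le> n") auto
  qed
  then show ?thesis
    using assms(2) by (cases "relaxation_time \<xi> \<omega>") (auto simp: enat_powr_def intro!: ennreal_leI powr_mono2)
qed

lemma moment_ge_survival:
  fixes M :: "'a measure"
  assumes "exclusion_voter_process \<beta> p M \<xi>" "\<P>(\<omega> in M. \<xi> 0 \<omega> = C) > 0" "0 \<le> a"
  shows "ennreal (real n powr a * survival \<beta> p n C)
    \<le> (\<integral>\<^sup>+ \<omega>. enat_powr (relaxation_time \<xi> \<omega>) a \<partial>uniform_measure M {\<omega> \<in> space M. \<xi> 0 \<omega> = C})"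
proof -
  interpret prob_space M using assms(1) by (simp add: exclusion_voter_process_def markov_chain_def)
  have [measurable]: "\<xi> i \<in> measurable M (count_space UNIV)" for i
    using assms(1) by (simp add: exclusion_voter_process_def markov_chain_def)
  let ?A = "{\<omega> \<in> space M. \<xi> 0 \<omega> = C}"
  let ?B = "{\<omega> \<in> space M. \<xi> 0 \<omega> = C \<and> (\<forall>i. 0 < i \<and> i \<le> n \<longrightarrow> \<xi> i \<omega> \<noteq> ground)}"
  let ?N = "uniform_measure M ?A"
  have A: "?A \<in> sets M" and B: "?B \<in> sets M" by measurable
  have "prob ?A * survival \<beta> p n C \<le> prob ?B"
    using markov_chain_survival[OF assms(1), of 0 "\<lambda>_. C" n] by simp
  then have "survival \<beta> p n C \<le> prob ?B / prob ?A"
    using assms(2) by (simp add: field_simps)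
  also have "\<dots> = measure ?N ?B"
  proof -
    have "?A \<inter> ?B = ?B" by auto
    then show ?thesis
      using assms(2) B by (simp add: emeasure_eq_measure)
  qed
  finally have surv: "survival \<beta> p n C \<le> measure ?N ?B" .
  interpret N: prob_space ?N
    by (rule prob_space_uniform_measure) (use assms(2) in \<open>auto simp: emeasure_eq_measure\<close>)
  have "ennreal (real n powr a * survival \<beta> p n C) \<le> ennreal (real n powr a) * emeasure ?N ?B"
    using surv by (simp add: N.emeasure_eq_measure ennreal_mult'[symmetric] ennreal_leI mult_left_mono)
  also have "\<dots> = (\<integral>\<^sup>+ \<omega>. ennreal (real n powr a) * indicator ?B \<omega> \<partial>?N)"
    using B by (intro nn_integral_cmult_indicator[symmetric]) simp
  also have "\<dots> \<le> (\<integral>\<^sup>+ \<omega>. enat_powr (relaxation_time \<xi> \<omega>) a \<partial>?N)"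
    by (intro nn_integral_mono) (auto split: split_indicator intro!: relaxation_time_powr_ge assms(3))
  finally show ?thesis .
qed

theorem theorem3:
  fixes \<beta> p \<epsilon> :: real
    and M :: "'a measure"
    and \<xi> :: "nat \<Rightarrow> 'a \<Rightarrow> conf"
    and S\<^sub>0 :: conf
  assumes "0 \<le> p" "p \<le> 1 / 2"
    and "0 \<le> \<beta>" "\<beta> \<le> 1"
    and "\<epsilon> > 0"
    and "S\<^sub>0 \<noteq> ground"
    and "exclusion_voter_process \<beta> p M \<xi>"
    and "\<P>(\<omega> in M. \<xi> 0 \<omega> = S\<^sub>0) > 0"
  shows "(\<integral>\<^sup>+ \<omega>. enat_powr (relaxation_time \<xi> \<omega>) (2 + \<epsilon>)
            \<partial>uniform_measure M {\<omega> \<in> space M. \<xi> 0 \<omega> = S\<^sub>0}) = \<infinity>"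
    (is "?E = _")
proof (rule ccontr)
  assume "?E \<noteq> \<infinity>"
  then obtain r where r: "?E = ennreal r" "0 \<le> r" by (cases ?E) auto
  obtain \<delta> K where \<delta>: "\<delta> > 0"
    and tail: "\<And>k. k \<ge> K \<Longrightarrow> k > 0 \<Longrightarrow> \<delta> / real k ^ 4 \<le> survival \<beta> p (k\<^sup>2) S\<^sub>0"
    using survival_tail[OF assms(6,3,4,1,2)] by blast
  \<comment> \<open>The lower bound \<open>\<delta> k\<^sup>2\<^sup>\<epsilon>\<close> exceeds \<open>r\<close> as soon as \<open>k\<^sup>2\<^sup>\<epsilon>\<close> is at least \<open>R\<close>.\<close>
  define R where "R = (r + 1) / \<delta>"
  have R: "R > 0" using r \<delta> by (simp add: R_def)
  define k where "k = max (max K 1) (nat \<lceil>R powr (1 / (2 * \<epsilon>))\<rceil>)"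
  have k: "k \<ge> K" "k > 0" "R powr (1 / (2 * \<epsilon>)) \<le> real k"
    unfolding k_def by (auto, linarith)
  have "R = (R powr (1 / (2 * \<epsilon>))) powr (2 * \<epsilon>)"
    using R assms(5) by (simp add: powr_powr)
  also have "\<dots> \<le> real k powr (2 * \<epsilon>)"
    using k(3) assms(5) by (intro powr_mono2) auto
  finally have "r + 1 \<le> real k powr (2 * \<epsilon>) * \<delta>"
    using \<delta> by (simp add: R_def pos_divide_le_eq)
  also have "\<dots> = real (k\<^sup>2) powr (2 + \<epsilon>) * (\<delta> / real k ^ 4)"
  proof -
    have "real (k\<^sup>2) powr (2 + \<epsilon>) = (real k powr 2) powr (2 + \<epsilon>)"
      using k(2) by simp
    also have "\<dots> = real k powr (4 + 2 * \<epsilon>)" by (simp only: powr_powr distrib_left) simp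
    also have "\<dots> = real k ^ 4 * real k powr (2 * \<epsilon>)"
      using k(2) by (simp add: powr_add)
    finally show ?thesis using k(2) by simp
  qed
  also have "\<dots> \<le> real (k\<^sup>2) powr (2 + \<epsilon>) * survival \<beta> p (k\<^sup>2) S\<^sub>0"
    using tail[OF k(1,2)] by (intro mult_left_mono) auto
  finally have "ennreal (r + 1) \<le> ennreal (real (k\<^sup>2) powr (2 + \<epsilon>) * survival \<beta> p (k\<^sup>2) S\<^sub>0)"
    by (rule ennreal_leI)
  also have "\<dots> \<le> ?E"
    by (rule moment_ge_survival) (use assms in auto)
  finally show False using r by simp
qed

end
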